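(* For each of the Dynkin types $B_k$ and $C_k$, the number of non-zero integral friezes of that type is twice the number of positive friezes of that type.
   Context: Given a skew-symmetrizable integer matrix $(b_{ij})$, the associated coefficient-free cluster algebra is the subring, generated over $\mathbb{Z}$ by all cluster variables, of the field of rational functions in the initial variables; mutation of a seed at $j$ replaces $x_j$ by $x_j'$ with $x_jx_j'=\prod_{b_{ij}>0}x_i^{b_{ij}}+\prod_{b_{ij}<0}x_i^{-b_{ij}}$. The cluster algebras of types $B_k$ and $C_k$ are obtained by folding. Let $\Delta$ be a Dynkin quiver (an orientation of a simply laced Dynkin diagram) with exchange matrix $(b_{ij})$ and $G$ a group of automorphisms of the quiver $\Delta$. The valued quiver $\Delta/G$ has as vertices the $G$-orbits of vertices of $\Delta$ and exchange matrix $b_{O,O'}=\sum_{i\in O}b_{ij}$ for any $j\in O'$. Type $B_k$ is $D_{k+1}/G$, where $G$ is generated by the automorphism swapping the two short arms of $D_{k+1}$; type $C_k$ is $A_{2k-1}/G$, where $G$ is generated by the reflection of the diagram $A_{2k-1}$ through its centre node. (The choice of orientation compatible with $G$ does not affect the cluster algebra up to isomorphism.) Here $k\ge 2$, the standard range for these types. A non-zero integral frieze of a given type is a ring homomorphism from the cluster algebra of that type to $\mathbb{Z}$ sending every cluster variable to a non-zero integer; equivalently, an assignment of a non-zero integer to each cluster variable such that all mutation (exchange) relations hold. A positive frieze is such a homomorphism sending every cluster variable to a positive integer. *)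

theory Defs
  imports
    "HOL.Hull"
    "HOL-Library.Poly_Mapping"
    "HOL-Library.FuncSet"
    "HOL-Library.Equipollence"
    "HOL-Computational_Algebra.Fraction_Field"
    "HOL-Combinatorics.Transposition"
begin

section \<open>Coefficient-free cluster algebras\<close>

text \<open>Polynomials are finitely supported maps from exponent vectors to coefficients. The
  fraction field of integer polynomials is the field of rational functions over the rationals.
  There is one indeterminate for every natural number; for a cluster algebra with
  finite index set \<open>V\<close> only those with index in \<open>V\<close> occur.\<close>

type_synonym ratfun = "((nat \<Rightarrow>\<^sub>0 nat) \<Rightarrow>\<^sub>0 int) fract"

definition var :: "nat \<Rightarrow> ratfun" where
  "var i = Fract (Poly_Mapping.single (Poly_Mapping.single i 1) 1) 1"

type_synonym exchange_matrix = "nat \<Rightarrow> nat \<Rightarrow> int"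

definition mutate_matrix :: "nat \<Rightarrow> exchange_matrix \<Rightarrow> exchange_matrix" where
  "mutate_matrix k B = (\<lambda>i j. if i = k \<or> j = k then - B i j
     else B i j + sgn (B i k) * max 0 (B i k * B k j))"

definition mutate_cluster ::
  "nat set \<Rightarrow> nat \<Rightarrow> exchange_matrix \<Rightarrow> (nat \<Rightarrow> ratfun) \<Rightarrow> nat \<Rightarrow> ratfun" where
  "mutate_cluster V k B x = x(k :=
     ((\<Prod>i\<in>{i \<in> V. B i k > 0}. x i ^ nat (B i k))
      + (\<Prod>i\<in>{i \<in> V. B i k < 0}. x i ^ nat (- B i k))) / x k)"

inductive seed :: "nat set \<Rightarrow> exchange_matrix \<Rightarrow> exchange_matrix \<Rightarrow> (nat \<Rightarrow> ratfun) \<Rightarrow> bool"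
  for V :: "nat set" and B0 :: exchange_matrix
where
  initial: "seed V B0 B0 var"
| mutation: "seed V B0 B x \<Longrightarrow> k \<in> V \<Longrightarrow>
    seed V B0 (mutate_matrix k B) (mutate_cluster V k B x)"

definition cluster_variables :: "nat set \<Rightarrow> exchange_matrix \<Rightarrow> ratfun set" where
  "cluster_variables V B0 = {x i | B x i. seed V B0 B x \<and> i \<in> V}"

definition is_subring :: "'a::comm_ring_1 set \<Rightarrow> bool" where
  "is_subring R \<longleftrightarrow> 1 \<in> R \<and> (\<forall>a\<in>R. \<forall>b\<in>R. a - b \<in> R \<and> a * b \<in> R)"

definition cluster_algebra :: "nat set \<Rightarrow> exchange_matrix \<Rightarrow> ratfun set" where
  "cluster_algebra V B0 = is_subring hull cluster_variables V B0"


section \<open>Friezes\<close>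

text \<open>A homomorphism on a subring is represented by its extension with value
  \<open>undefined\<close> outside, so that distinct functions are distinct homomorphisms.\<close>

definition ring_homs :: "'a::comm_ring_1 set \<Rightarrow> ('a \<Rightarrow> int) set" where
  "ring_homs R = {f \<in> extensional R. f 1 = 1 \<and>
     (\<forall>a\<in>R. \<forall>b\<in>R. f (a + b) = f a + f b \<and> f (a * b) = f a * f b)}"

definition nonzero_friezes :: "nat set \<Rightarrow> exchange_matrix \<Rightarrow> (ratfun \<Rightarrow> int) set" where
  "nonzero_friezes V B = {f \<in> ring_homs (cluster_algebra V B). \<forall>x\<in>cluster_variables V B. f x \<noteq> 0}"

definition positive_friezes :: "nat set \<Rightarrow> exchange_matrix \<Rightarrow> (ratfun \<Rightarrow> int) set" where
  "positive_friezes V B = {f \<in> ring_homs (cluster_algebra V B). \<forall>x\<in>cluster_variables V B. f x > 0}"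


section \<open>Dynkin quivers and folding\<close>

definition edges_A :: "nat \<Rightarrow> nat set set" where
  "edges_A n = {{i, i + 1} | i. 1 \<le> i \<and> i < n}"

text \<open>The chain \<open>1, \<dots>, n - 1\<close> with \<open>n\<close> attached to \<open>n - 2\<close>; the
  short arms are \<open>n - 1\<close> and \<open>n\<close>. The graph for \<open>n = 3\<close> is that of type \<open>A\<^sub>3\<close>, with
  centre \<open>1\<close>.\<close>

definition edges_D :: "nat \<Rightarrow> nat set set" where
  "edges_D n = edges_A (n - 1) \<union> {{n - 2, n}}"

text \<open>A quiver is given by its set of arrows. In an orientation of a simple graph every edge
  underlies exactly one arrow.\<close>

definition orientation :: "nat set set \<Rightarrow> (nat \<times> nat) set \<Rightarrow> bool" where
  "orientation E Q \<longleftrightarrow> bij_betw (\<lambda>(i, j). {i, j}) Q E"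

definition quiver_matrix :: "(nat \<times> nat) set \<Rightarrow> exchange_matrix" where
  "quiver_matrix Q i j = of_bool ((i, j) \<in> Q) - of_bool ((j, i) \<in> Q)"

definition quiver_automorphism :: "nat set \<Rightarrow> (nat \<times> nat) set \<Rightarrow> (nat \<Rightarrow> nat) \<Rightarrow> bool" where
  "quiver_automorphism V Q g \<longleftrightarrow>
     bij_betw g V V \<and> (\<forall>i\<in>V. \<forall>j\<in>V. (g i, g j) \<in> Q \<longleftrightarrow> (i, j) \<in> Q)"

definition group_orbit :: "(nat \<Rightarrow> nat) set \<Rightarrow> nat \<Rightarrow> nat set" where
  "group_orbit G i = (\<lambda>g. g i) ` G"

text \<open>Indeterminates are indexed by natural numbers, so the vertices of the folded
  quiver are the least elements of the orbits instead of the orbits. The entry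
  \<open>b\<^bsub>O,O'\<^esub> = \<Sum>i\<in>O. b\<^bsub>ij\<^esub>\<close> does not depend on \<open>j \<in> O'\<close>; the least such \<open>j\<close> is used.\<close>

definition folded_vertices :: "(nat \<Rightarrow> nat) set \<Rightarrow> nat set \<Rightarrow> nat set" where
  "folded_vertices G V = (\<lambda>i. Min (group_orbit G i)) ` V"

definition folded_matrix :: "(nat \<Rightarrow> nat) set \<Rightarrow> exchange_matrix \<Rightarrow> exchange_matrix" where
  "folded_matrix G b p q = (\<Sum>i\<in>group_orbit G p. b i q)"

text \<open>Both automorphisms below are involutions \<open>\<sigma>\<close>, so the group they generate is
  \<open>{id, \<sigma>}\<close>. Every orientation preserved by \<open>\<sigma>\<close> is admitted.\<close>

definition type_B :: "nat \<Rightarrow> nat set \<Rightarrow> exchange_matrix \<Rightarrow> bool" where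
  "type_B k V B \<longleftrightarrow> (\<exists>Q. let \<sigma> = transpose k (k + 1); G = {id, \<sigma>} in
     orientation (edges_D (k + 1)) Q \<and>
     quiver_automorphism {1..k + 1} Q \<sigma> \<and>
     V = folded_vertices G {1..k + 1} \<and>
     B = folded_matrix G (quiver_matrix Q))"

definition type_C :: "nat \<Rightarrow> nat set \<Rightarrow> exchange_matrix \<Rightarrow> bool" where
  "type_C k V B \<longleftrightarrow> (\<exists>Q. let \<sigma> = (\<lambda>i. 2 * k - i); G = {id, \<sigma>} in
     orientation (edges_A (2 * k - 1)) Q \<and>
     quiver_automorphism {1..2 * k - 1} Q \<sigma> \<and>
     V = folded_vertices G {1..2 * k - 1} \<and>
     B = folded_matrix G (quiver_matrix Q))"

end

theory Submission
  imports Defs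
begin

text \<open>Multiplying every cluster variable by a suitable sign is an automorphism of the cluster algebra:
give the initial variables degrees in the integers mod 2 such that both monomials of each
exchange relation have the same degree, a property that survives mutation
(\<open>twist_seed\<close>). In type C the degree of \<open>x\<^sub>i\<close> is the parity of \<open>i\<close>; in type B only \<open>x\<^sub>k\<close> is
odd. Composition with this automorphism is an involution on the non-zero friezes, and it takes
positive friezes to friezes that are not positive. So there are at least twice as many non-zero
friezes as positive ones, and equality holds if, up to the involution, each non-zero frieze
is positive (\<open>friezes_double\<close>). Mutation is subtraction-free, so it is enough to know the signs
of the values at the initial variables.

Mutations at sources and sinks only change the orientation of the chain \<open>1, \<dots>, k\<close>. They make it
linear (\<open>slice_reorient\<close>), and from then on one pass of mutations at \<open>1, \<dots>, k\<close> after another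
(\<open>slice_pass\<close>) turns a frieze into a classical frieze pattern: an array \<open>a i t\<close> of
non-zero integers with \<open>a i t * a i (t + 1) = 1 + a (i - 1) (t + 1) * a (i + 1) t\<close>. In type B
the last row has to be squared. Since no entry vanishes, the entries are continuants of the first
row; the modified relation in the last row says that the first row has period \<open>k + 1\<close> and that the
monodromy matrix of a period has trace 0 in type C and trace 2 in type B.

It remains to see that a periodic integer sequence with a monodromy matrix of
trace between -2 and 2, and with non-zero continuants over all proper subwords of its period, has
constant sign (\<open>nondegenerate_same_sign\<close>). If all its members had absolute value at least 2, the
continuants would grow so fast that the trace is too large, unless all members are 2 or all are
-2. Otherwise some member is 1 or -1, and it can be removed just as an ear is cut off a
triangulated polygon; this shortens the period. A constant sign of the
first row determines the signs of all rows (\<open>frieze_pattern_signs\<close>): all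
positive, or those of the automorphism. In type B the last row consists of squares, which with the
trace 2 leaves the first case only, and the sign of \<open>x\<^sub>k\<close> is the one choice that remains.\<close>

section \<open>Continuants of cyclic words\<close>

datatype mat2 = Mat (e11: int) (e12: int) (e21: int) (e22: int)

instantiation mat2 :: monoid_mult
begin

definition one_mat2 :: mat2 where
  "1 = Mat 1 0 0 1"

fun times_mat2 :: "mat2 \<Rightarrow> mat2 \<Rightarrow> mat2" where
  "Mat a b c d * Mat a' b' c' d' = Mat (a * a' + b * c') (a * b' + b * d') (c * a' + d * c') (c * b' + d * d')"

instance
proof
  fix x y z :: mat2
  show "x * y * z = x * (y * z)"
    by (cases x; cases y; cases z) (simp add: algebra_simps)
  show "1 * x = x"
    by (cases x) (simp add: one_mat2_def)
  show "x * 1 = x"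
    by (cases x) (simp add: one_mat2_def)
qed

end

definition tr :: "mat2 \<Rightarrow> int" where
  "tr x = e11 x + e22 x"

definition det2 :: "mat2 \<Rightarrow> int" where
  "det2 x = e11 x * e22 x - e12 x * e21 x"

text \<open>The recurrence \<open>v\<^bsub>t+1\<^esub> = c\<^sub>t v\<^sub>t - v\<^bsub>t-1\<^esub>\<close> in
matrix form. The four entries of the product over a word are, up to sign, the continuants of the word and of the
words left after dropping its first letter, its last letter, or both.\<close>

definition letter :: "int \<Rightarrow> mat2" where
  "letter c = Mat c (- 1) 1 0"

definition word :: "int list \<Rightarrow> mat2" where
  "word cs = prod_list (map letter cs)"

definition continuant :: "int list \<Rightarrow> int" where
  "continuant cs = e11 (word cs)"

lemma entries_times [simp]:
  "e11 (x * y) = e11 x * e11 y + e12 x * e21 y"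
  "e12 (x * y) = e11 x * e12 y + e12 x * e22 y"
  "e21 (x * y) = e21 x * e11 y + e22 x * e21 y"
  "e22 (x * y) = e21 x * e12 y + e22 x * e22 y"
  by (cases x; cases y; simp)+

lemma entries_one [simp]: "e11 1 = 1" "e12 1 = 0" "e21 1 = 0" "e22 1 = 1"
  by (simp_all add: one_mat2_def)

lemma entries_letter [simp]:
  "e11 (letter c) = c" "e12 (letter c) = - 1" "e21 (letter c) = 1" "e22 (letter c) = 0"
  by (simp_all add: letter_def)

lemma word_simps [simp]:
  "word [] = 1" "word (c # cs) = letter c * word cs" "word (cs @ ds) = word cs * word ds"
  by (simp_all add: word_def)

lemma tr_commute: "tr (x * y) = tr (y * x)"
  by (simp add: tr_def algebra_simps)

lemma det2_word: "det2 (word cs) = 1"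
  by (induction cs) (simp_all add: det2_def algebra_simps)

lemma continuant_Nil [simp]: "continuant [] = 1" and continuant_single [simp]: "continuant [c] = c"
  by (simp_all add: continuant_def)

lemma continuant_Cons_snoc:
  "continuant (c # cs @ [d]) * continuant cs = continuant (c # cs) * continuant (cs @ [d]) - 1"
  using det2_word[of cs] unfolding continuant_def det2_def by (simp add: algebra_simps)

lemma continuant_Cons_Cons: "continuant (c # d # cs) = c * continuant (d # cs) - continuant cs"
  by (simp add: continuant_def)

lemma continuant_snoc_snoc: "continuant (cs @ [c, d]) = continuant (cs @ [c]) * d - continuant cs"
  by (simp add: continuant_def algebra_simps)

lemma tr_word_Cons_snoc: "tr (word (c # cs @ [d])) = continuant (c # cs @ [d]) - continuant cs"
  by (simp add: tr_def continuant_def algebra_simps)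

text \<open>A new letter \<open>c\<close> replaces the pair \<open>(r, p)\<close> of entries in a column by
\<open>(p, c p - r)\<close>, and \<open>\<bar>c p - r\<bar> \<ge> 2 \<bar>p\<bar> - \<bar>r\<bar>\<close>, so the
entries keep growing.\<close>

lemma word_growth_left:
  assumes "cs \<noteq> []" "\<forall>c\<in>set cs. 2 \<le> \<bar>c\<bar>"
  shows "\<bar>e21 (word cs)\<bar> < \<bar>e11 (word cs)\<bar>"
  using assms
proof (induction cs rule: list_nonempty_induct)
  case (single x)
  then show ?case by simp
next
  case (cons x xs)
  let ?p = "e11 (word xs)" and ?r = "e21 (word xs)"
  have "\<bar>x * ?p\<bar> \<le> \<bar>x * ?p - ?r\<bar> + \<bar>?r\<bar>" by linarith
  moreover have "2 * \<bar>?p\<bar> \<le> \<bar>x * ?p\<bar>"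
    using cons.prems by (simp add: abs_mult mult_right_mono)
  ultimately show ?case using cons by simp
qed

lemma word_growth_right:
  assumes "cs \<noteq> []" "\<forall>c\<in>set cs. 2 \<le> \<bar>c\<bar>"
  shows "\<bar>e22 (word cs)\<bar> < \<bar>e21 (word cs)\<bar>"
  using assms
proof (induction cs rule: rev_nonempty_induct)
  case (single x)
  then show ?case by simp
next
  case (snoc x xs)
  let ?r = "e21 (word xs)" and ?s = "e22 (word xs)"
  have "\<bar>?r * x\<bar> \<le> \<bar>?r * x + ?s\<bar> + \<bar>?s\<bar>" by linarith
  moreover have "2 * \<bar>?r\<bar> \<le> \<bar>?r * x\<bar>"
    using snoc.prems mult_right_mono[of 2 "\<bar>x\<bar>" "\<bar>?r\<bar>"] by (simp add: abs_mult mult.commute)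
  ultimately show ?case using snoc by simp
qed

text \<open>The difference of the absolute values in the first column starts at \<open>\<bar>c\<bar> - 1\<close>
and never decreases. It stays at its least value 1 only if each new letter \<open>c\<close> is 2 in absolute value
and has the sign for which \<open>c p\<close> and \<open>r\<close> partly cancel, which is the sign of the letters
already there. The two inequalities on the entries carry this sign through the induction.\<close>

lemma minimal_growth:
  assumes "cs \<noteq> []" "\<forall>c\<in>set cs. 2 \<le> \<bar>c\<bar>" "\<bar>e11 (word cs)\<bar> \<le> \<bar>e21 (word cs)\<bar> + 1"
  shows "\<exists>\<epsilon>\<in>{1, - 1}. (\<forall>c\<in>set cs. c = 2 * \<epsilon>) \<and> 0 < \<epsilon> * e11 (word cs) * e21 (word cs)
    \<and> 0 < \<epsilon> ^ length cs * e11 (word cs)"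
  using assms
proof (induction cs rule: list_nonempty_induct)
  case (single x)
  then have "x = 2 \<or> x = - 2" by auto
  then show ?case by auto
next
  case (cons x xs)
  let ?p = "e11 (word xs)" and ?r = "e21 (word xs)"
  have x2: "2 \<le> \<bar>x\<bar>" using cons.prems by simp
  have le: "\<bar>x * ?p - ?r\<bar> \<le> \<bar>?p\<bar> + 1" using cons.prems by simp
  have "\<bar>x * ?p\<bar> \<le> \<bar>x * ?p - ?r\<bar> + \<bar>?r\<bar>" by linarith
  moreover have "2 * \<bar>?p\<bar> \<le> \<bar>x * ?p\<bar>"
    using x2 by (simp add: abs_mult mult_right_mono)
  ultimately have "\<bar>?p\<bar> \<le> \<bar>?r\<bar> + 1" using le by linarith
  then obtain \<epsilon> where e: "\<epsilon> \<in> {1, - 1}" and all: "\<forall>c\<in>set xs. c = 2 * \<epsilon>"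
    and pr: "0 < \<epsilon> * ?p * ?r" and p: "0 < \<epsilon> ^ length xs * ?p"
    using cons.IH cons.prems by (meson list.set_intros(2))
  have gr: "\<bar>?r\<bar> < \<bar>?p\<bar>" using word_growth_left[of xs] cons by simp
  have ee: "\<epsilon> * \<epsilon> = 1" using e by auto
  \<comment> \<open>Up to the common sign the new entry is \<open>\<epsilon> x P - R\<close> with \<open>P > R > 0\<close>.\<close>
  define P R y where "P = \<bar>?p\<bar>" and "R = \<bar>?r\<bar>" and "y = \<epsilon> * x"
  have PR: "0 < R" "R < P" using pr gr by (auto simp: P_def R_def)
  obtain \<eta> where eta: "\<eta> \<in> {1, - 1}" "?p = \<eta> * P"
  proof (cases "0 \<le> ?p")
    case True
    then show ?thesis using that[of 1] by (simp add: P_def)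
  next
    case False
    then show ?thesis using that[of "- 1"] by (simp add: P_def)
  qed
  have r: "?r = \<epsilon> * \<eta> * R"
  proof -
    have "0 < (\<epsilon> * \<eta> * ?r) * P" using pr eta by (simp add: algebra_simps)
    then have "0 < \<epsilon> * \<eta> * ?r" using PR by (simp add: zero_less_mult_iff)
    moreover have "\<bar>\<epsilon> * \<eta> * ?r\<bar> = R" using e eta by (auto simp: R_def)
    ultimately have "\<epsilon> * \<eta> * ?r = R" by simp
    then show ?thesis using e eta by auto
  qed
  have new: "x * ?p - ?r = \<epsilon> * \<eta> * (y * P - R)"
    unfolding y_def r eta(2) using e by (auto simp: algebra_simps)
  have "\<bar>y * P - R\<bar> = \<bar>x * ?p - ?r\<bar>"
    unfolding new using e eta(1) by auto
  then have le': "\<bar>y * P - R\<bar> \<le> P + 1" using le by (simp add: P_def)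
  have y2: "2 \<le> \<bar>y\<bar>" using x2 e by (auto simp: y_def)
  have y: "y = 2"
  proof (rule ccontr)
    assume "y \<noteq> 2"
    then consider "3 \<le> y" | "y \<le> - 2" using y2 by linarith
    then show False
    proof cases
      case 1
      then have "3 * P \<le> y * P" using PR by simp
      then show False using le' PR by linarith
    next
      case 2
      then have "y * P \<le> (- 2) * P" using PR by (intro mult_right_mono) auto
      then show False using le' PR by linarith
    qed
  qed
  then have x: "x = 2 * \<epsilon>" using e by (auto simp: y_def)
  have new': "x * ?p - ?r = \<epsilon> * \<eta> * (2 * P - R)" using new y by simp
  have pos: "0 < 2 * P - R" using PR by simp
  have "0 < \<epsilon> * (x * ?p - ?r) * ?p"
  proof -
    have "\<epsilon> * (x * ?p - ?r) * ?p = (2 * P - R) * P"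
      unfolding new' by (subst eta(2)) (use e eta(1) in auto)
    then show ?thesis using pos PR by simp
  qed
  moreover have "0 < \<epsilon> ^ length (x # xs) * (x * ?p - ?r)"
  proof -
    have "\<epsilon> ^ length (x # xs) * (x * ?p - ?r) = (\<epsilon> * \<epsilon>) * (\<epsilon> ^ length xs * \<eta>) * (2 * P - R)"
      unfolding new' by simp
    also have "\<dots> = (\<epsilon> ^ length xs * \<eta>) * (2 * P - R)" using ee by simp
    finally have eq: "\<epsilon> ^ length (x # xs) * (x * ?p - ?r) = (\<epsilon> ^ length xs * \<eta>) * (2 * P - R)" .
    have "0 < (\<epsilon> ^ length xs * \<eta>) * P" using p eta(2) by (simp add: mult.assoc)
    then have "0 < \<epsilon> ^ length xs * \<eta>" using PR by (simp add: zero_less_mult_iff)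
    then show ?thesis unfolding eq using pos by (rule mult_pos_pos)
  qed
  ultimately show ?case using e x all by (intro bexI[of _ \<epsilon>]) auto
qed

text \<open>The trace is at least \<open>\<bar>e11\<bar> - \<bar>e22\<bar>\<close> in absolute value, which is the
sum of the two growth steps \<open>\<bar>e11\<bar> - \<bar>e21\<bar>\<close> and \<open>\<bar>e21\<bar> -
\<bar>e22\<bar>\<close>. A trace of absolute value at most 2 forces both to be 1.\<close>

lemma small_trace_large_letters:
  assumes "cs \<noteq> []" "\<forall>c\<in>set cs. 2 \<le> \<bar>c\<bar>" "\<bar>tr (word cs)\<bar> \<le> 2"
  shows "\<exists>\<epsilon>\<in>{1, - 1}. (\<forall>c\<in>set cs. c = 2 * \<epsilon>) \<and> 0 < \<epsilon> ^ length cs * tr (word cs)"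
proof -
  let ?w = "word cs"
  have g: "\<bar>e21 ?w\<bar> < \<bar>e11 ?w\<bar>" "\<bar>e22 ?w\<bar> < \<bar>e21 ?w\<bar>"
    using word_growth_left word_growth_right assms by auto
  then have "\<bar>e11 ?w\<bar> \<le> \<bar>e21 ?w\<bar> + 1" using assms(3) unfolding tr_def by linarith
  from minimal_growth[OF assms(1,2) this] obtain \<epsilon> where e: "\<epsilon> \<in> {1, - 1}"
    and all: "\<forall>c\<in>set cs. c = 2 * \<epsilon>" and p: "0 < \<epsilon> ^ length cs * e11 ?w" by meson
  have "\<epsilon> ^ length cs = 1 \<or> \<epsilon> ^ length cs = - 1"
    using e by (cases "even (length cs)") auto
  then have "0 < \<epsilon> ^ length cs * tr ?w"
    using p g unfolding tr_def by auto
  then show ?thesis using e all by blast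
qed

definition rotation :: "'a list \<Rightarrow> 'a list \<Rightarrow> bool" where
  "rotation xs ys \<longleftrightarrow> (\<exists>us vs. xs = us @ vs \<and> ys = vs @ us)"

lemma rotation_refl: "rotation xs xs"
  unfolding rotation_def by (metis append_Nil append_Nil2)

lemma rotation_trans:
  assumes "rotation xs ys" "rotation ys zs"
  shows "rotation xs zs"
proof -
  have r: "rotation us vs \<longleftrightarrow> (\<exists>n. vs = rotate n us)" for us vs :: "'a list"
    unfolding rotation_def
    by (metis append_take_drop_id rotate_append rotate_drop_take)
  show ?thesis using assms unfolding r by (metis rotate_rotate)
qed

lemma rotation_length: "rotation xs ys \<Longrightarrow> length ys = length xs"
  and rotation_set: "rotation xs ys \<Longrightarrow> set ys = set xs"
  unfolding rotation_def by auto

lemma rotation_tr: "rotation xs ys \<Longrightarrow> tr (word ys) = tr (word xs)"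
  unfolding rotation_def using tr_commute by auto

lemma rotation_head: "x \<in> set xs \<Longrightarrow> \<exists>ys. rotation xs (x # ys)"
  unfolding rotation_def by (metis append_Cons in_set_conv_decomp)

text \<open>The letters sit at the vertices of a polygon around a puncture. The continuant of a word of consecutive
letters is the length of the arc that cuts off these vertices, and the condition is that no arc turning less than
once around the puncture has length 0.\<close>

definition nondegenerate :: "int list \<Rightarrow> bool" where
  "nondegenerate cs \<longleftrightarrow> (\<forall>us vs. rotation cs (us @ vs) \<longrightarrow> us \<noteq> [] \<longrightarrow> vs \<noteq> [] \<longrightarrow> continuant us \<noteq> 0)"

lemma nondegenerate_rotation: "nondegenerate cs \<Longrightarrow> rotation cs ds \<Longrightarrow> nondegenerate ds"
  unfolding nondegenerate_def using rotation_trans by blast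

lemma nondegenerate_letter:
  assumes "nondegenerate cs" "2 \<le> length cs" "c \<in> set cs"
  shows "c \<noteq> 0"
proof -
  obtain ds where ds: "rotation cs ([c] @ ds)" using rotation_head[OF assms(3)] by auto
  then have "ds \<noteq> []" using rotation_length[OF ds] assms(2) by auto
  then show ?thesis using assms(1) ds continuant_single unfolding nondegenerate_def by blast
qed

lemma list_two_ends: "2 \<le> length xs \<Longrightarrow> \<exists>a ys b. xs = a # ys @ [b]"
  by (metis One_nat_def Suc_1 Suc_le_length_iff list.size(3) not_one_le_zero rev_exhaust)

text \<open>The effect on the letters when the vertex with letter \<open>\<epsilon>\<close>, between
\<open>b\<close> and \<open>a\<close> in cyclic order, is cut off.\<close>

definition contract :: "int \<Rightarrow> int \<Rightarrow> int list \<Rightarrow> int \<Rightarrow> int list" where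
  "contract \<epsilon> a ys b = (a - \<epsilon>) # ys @ [b - \<epsilon>]"

lemma contract_continuant:
  assumes "\<epsilon> \<in> {1, - 1}"
  shows "continuant ((a - \<epsilon>) # w) = \<epsilon> * continuant (\<epsilon> # a # w)"
    and "continuant (w @ [b - \<epsilon>]) = \<epsilon> * continuant (w @ [b, \<epsilon>])"
    and "continuant (v @ [b - \<epsilon>, a - \<epsilon>] @ w) = \<epsilon> * continuant (v @ [b, \<epsilon>, a] @ w)"
  using assms by (auto simp: continuant_def algebra_simps)

lemma contract_tr:
  assumes "\<epsilon> \<in> {1, - 1}"
  shows "tr (word (contract \<epsilon> a ys b)) = \<epsilon> * tr (word (\<epsilon> # a # ys @ [b]))"
  using assms by (auto simp: tr_def contract_def algebra_simps)

text \<open>Each arc of the smaller polygon is an arc of the larger one. Its word gets the letter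
\<open>\<epsilon>\<close> back if it meets a neighbour of the removed vertex, and
\<open>contract_continuant\<close> says that this changes the continuant by a sign at most. The cases are those of
how the arc meets the two neighbours.\<close>

lemma contract_nondegenerate:
  assumes e: "\<epsilon> \<in> {1, - 1}" and nd: "nondegenerate (\<epsilon> # a # ys @ [b])"
  shows "nondegenerate (contract \<epsilon> a ys b)"
  unfolding nondegenerate_def
proof (intro allI impI)
  fix w z
  assume "rotation (contract \<epsilon> a ys b) (w @ z)" and w: "w \<noteq> []" and z: "z \<noteq> []"
  then obtain p q where pq: "(a - \<epsilon>) # ys @ [b - \<epsilon>] = p @ q" and wz: "w @ z = q @ p"
    unfolding rotation_def contract_def by auto
  have e0: "\<epsilon> \<noteq> 0" using e by auto
  have nz: "continuant us \<noteq> 0" if "rotation (\<epsilon> # a # ys @ [b]) (us @ vs)" "us \<noteq> []" "vs \<noteq> []" for us vs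
    using nd that unfolding nondegenerate_def by blast
  \<comment> \<open>An arc that does not pass over the deleted vertex, possibly ending next to it.\<close>
  have linear: "continuant w \<noteq> 0" if eq: "(a - \<epsilon>) # ys @ [b - \<epsilon>] = p @ w @ u" and ne: "p \<noteq> [] \<or> u \<noteq> []" for p u
  proof (cases p)
    case Nil
    then obtain w' where w': "w = (a - \<epsilon>) # w'" "ys @ [b - \<epsilon>] = w' @ u"
      using eq w by (cases w) auto
    then obtain u' where u': "u = u' @ [b - \<epsilon>]" "ys = w' @ u'"
      using ne Nil by (cases u rule: rev_cases) (auto simp flip: append_assoc)
    have "rotation (\<epsilon> # a # ys @ [b]) ((\<epsilon> # a # w') @ (u' @ [b]))"
      using u' rotation_refl by simp
    then have "continuant (\<epsilon> # a # w') \<noteq> 0" by (rule nz) auto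
    then show ?thesis using w' contract_continuant(1)[OF e] e0 by simp
  next
    case (Cons p0 p')
    then have eq': "ys @ [b - \<epsilon>] = p' @ w @ u" using eq by simp
    show ?thesis
    proof (cases u rule: rev_cases)
      case Nil
      then obtain w' where w': "w = w' @ [b - \<epsilon>]" "ys = p' @ w'"
        using eq' w by (cases w rule: rev_cases) (auto simp flip: append_assoc)
      have "rotation (\<epsilon> # a # ys @ [b]) ((w' @ [b, \<epsilon>]) @ (a # p'))"
        unfolding rotation_def
        by (rule exI[of _ "\<epsilon> # a # p'"], rule exI[of _ "w' @ [b]"]) (simp add: w')
      then have "continuant (w' @ [b, \<epsilon>]) \<noteq> 0" by (rule nz) auto
      then show ?thesis using w' contract_continuant(2)[OF e] e0 by simp
    next
      case (snoc u' u1)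
      then have "ys = p' @ w @ u'" using eq' by (simp flip: append_assoc)
      then have "rotation (\<epsilon> # a # ys @ [b]) (w @ (u' @ [b, \<epsilon>, a] @ p'))"
        unfolding rotation_def
        by (intro exI[of _ "\<epsilon> # a # p'"] exI[of _ "w @ u' @ [b]"]) simp
      then show ?thesis by (rule nz) (use w in auto)
    qed
  qed
  from wz consider u where "q = w @ u" "z = u @ p" | u where "w = q @ u" "p = u @ z"
    by (auto simp: append_eq_append_conv2)
  then show "continuant w \<noteq> 0"
  proof cases
    case 1
    then show ?thesis using linear[of p u] pq z by auto
  next
    case (2 u)
    show ?thesis
    proof (cases "u = [] \<or> q = []")
      case True
      then show ?thesis
      proof
        assume "u = []"
        then show ?thesis using linear[of p "[]"] 2 pq z by auto
      next
        assume "q = []"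
        then show ?thesis using linear[of "[]" z] 2 pq z by auto
      qed
    next
      case False
      then obtain u' q' where uq: "u = (a - \<epsilon>) # u'" "q = q' @ [b - \<epsilon>]" "ys = u' @ z @ q'"
        using pq 2 by (cases u; cases q rule: rev_cases) (auto simp flip: append_assoc)
      have "rotation (\<epsilon> # a # ys @ [b]) ((q' @ [b, \<epsilon>, a] @ u') @ z)"
        unfolding rotation_def
        by (intro exI[of _ "\<epsilon> # a # u' @ z"] exI[of _ "q' @ [b]"]) (simp add: uq)
      then have "continuant (q' @ [b, \<epsilon>, a] @ u') \<noteq> 0" by (rule nz) (use z in auto)
      then show ?thesis using 2 uq contract_continuant(3)[OF e] e0 by simp
    qed
  qed
qed

text \<open>Induction on the number of letters; for two letters the trace is their product minus 2. If all letters
have absolute value at least 2, the bound on the trace decides. Otherwise a letter \<open>\<epsilon>\<close> that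
is 1 or -1 is cut off, and the other letters, after subtraction of \<open>\<epsilon>\<close> at its neighbours,
have a common sign by induction. If it is \<open>\<epsilon>\<close>, all is well. If not, \<open>\<epsilon>\<close>
is the only letter of its sign. A letter \<open>- \<epsilon>\<close> elsewhere could then be cut off instead, and
the result would have a letter with the sign of \<open>\<epsilon>\<close> and another one that is 0 or of the
opposite sign, against the induction hypothesis. Hence the other letters are at least 2 in absolute value, and the
shorter word has a letter of absolute value at least 3, which the trace does not permit. The lower bound on the
trace separates the two signs: negating all letters multiplies the trace by \<open>(-1)\<^sup>n\<close> for
\<open>n\<close> letters.\<close>

theorem nondegenerate_same_sign:
  assumes "2 \<le> length cs" "nondegenerate cs" "\<bar>tr (word cs)\<bar> \<le> 2"
  shows "\<exists>\<epsilon>\<in>{1, - 1}. (\<forall>c\<in>set cs. 0 < \<epsilon> * c) \<and> - 2 < \<epsilon> ^ length cs * tr (word cs)"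
  using assms
proof (induction "length cs" arbitrary: cs rule: less_induct)
  case less
  note nz = nondegenerate_letter[OF less.prems(2,1)]
  have contraction:
    "\<exists>\<delta>\<in>{1, - 1}. (\<forall>c\<in>set (contract \<epsilon> a ys b). 0 < \<delta> * c)
       \<and> - 2 < \<delta> ^ length (contract \<epsilon> a ys b) * (\<epsilon> * tr (word cs))"
    if e: "\<epsilon> \<in> {1, - 1}" and rot: "rotation cs (\<epsilon> # a # ys @ [b])" for \<epsilon> a ys b
  proof -
    have len: "length cs = length (contract \<epsilon> a ys b) + 1"
      using rotation_length[OF rot] by (simp add: contract_def)
    have tr: "tr (word (contract \<epsilon> a ys b)) = \<epsilon> * tr (word cs)"
      using contract_tr[OF e] rotation_tr[OF rot] by metis
    have "\<bar>tr (word (contract \<epsilon> a ys b))\<bar> \<le> 2"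
      using tr less.prems(3) e by auto
    moreover have "nondegenerate (contract \<epsilon> a ys b)"
      using contract_nondegenerate[OF e nondegenerate_rotation[OF less.prems(2) rot]] .
    moreover have "2 \<le> length (contract \<epsilon> a ys b)" by (simp add: contract_def)
    ultimately show ?thesis using less.hyps[of "contract \<epsilon> a ys b"] len tr by simp
  qed
  consider "length cs = 2" | "3 \<le> length cs" "\<forall>c\<in>set cs. 2 \<le> \<bar>c\<bar>"
    | c where "3 \<le> length cs" "c \<in> set cs" "\<not> 2 \<le> \<bar>c\<bar>"
    using less.prems(1) by fastforce
  then show ?case
  proof cases
    case 1
    then obtain x y where cs: "cs = [x, y]"
      by (auto simp: length_Suc_conv eval_nat_numeral)
    have tr: "tr (word cs) = x * y - 2" by (simp add: cs tr_def)
    have "x \<noteq> 0" "y \<noteq> 0" using nz cs by auto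
    then have "0 < x * y" using tr less.prems(3) by (smt (verit) mult_eq_0_iff)
    then have "(0 < x \<and> 0 < y) \<or> (x < 0 \<and> y < 0)" by (auto simp: zero_less_mult_iff)
    then show ?thesis
    proof
      assume "0 < x \<and> 0 < y"
      then show ?thesis using tr \<open>0 < x * y\<close> by (intro bexI[of _ 1]) (auto simp: cs)
    next
      assume "x < 0 \<and> y < 0"
      then show ?thesis using tr \<open>0 < x * y\<close> by (intro bexI[of _ "- 1"]) (auto simp: cs)
    qed
  next
    case 2
    then have "cs \<noteq> []" by auto
    then obtain \<epsilon> where e: "\<epsilon> \<in> {1, - 1}" "\<forall>c\<in>set cs. c = 2 * \<epsilon>"
      "0 < \<epsilon> ^ length cs * tr (word cs)"
      using small_trace_large_letters[OF _ 2(2) less.prems(3)] by meson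
    then show ?thesis by (intro bexI[of _ \<epsilon>]) auto
  next
    case (3 \<epsilon>)
    then have e: "\<epsilon> \<in> {1, - 1}" using nz[OF 3(2)] by auto
    have ee: "\<epsilon> * \<epsilon> = 1" using e by auto
    obtain zs where rot: "rotation cs (\<epsilon> # zs)" using rotation_head[OF 3(2)] by auto
    obtain a ys b where zs: "zs = a # ys @ [b]"
      using list_two_ends[of zs] rotation_length[OF rot] 3(1) by auto
    have set_cs: "set cs = insert \<epsilon> (insert a (insert b (set ys)))"
      using rotation_set[OF rot] zs by auto
    have len: "length (contract \<epsilon> a ys b) + 1 = length cs"
      using rotation_length[OF rot] zs by (simp add: contract_def)
    obtain \<delta> where d: "\<delta> \<in> {1, - 1}" and pos: "\<forall>c\<in>set (contract \<epsilon> a ys b). 0 < \<delta> * c"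
      and trd: "- 2 < \<delta> ^ length (contract \<epsilon> a ys b) * (\<epsilon> * tr (word cs))"
      using contraction[OF e] rot zs by blast
    show ?thesis
    proof (cases "\<delta> = \<epsilon>")
      case True
      have "\<forall>c\<in>set cs. 0 < \<epsilon> * c"
        using pos e unfolding set_cs True contract_def by auto
      moreover have "- 2 < \<epsilon> ^ length cs * tr (word cs)"
        using trd unfolding True len[symmetric] by (simp add: algebra_simps)
      ultimately show ?thesis using e by blast
    next
      case False
      then have "\<delta> = - \<epsilon>" using d e by auto
      then have pos': "\<forall>c\<in>set (contract \<epsilon> a ys b). \<epsilon> * c < 0" using pos by auto
      have "a \<noteq> 0" "b \<noteq> 0" using nz set_cs by auto
      then have neg: "\<forall>c\<in>set zs. \<epsilon> * c < 0"
        using pos' e unfolding zs contract_def by auto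
      have False
      proof (cases "- \<epsilon> \<in> set zs")
        case True
        then obtain p q where pq: "zs = p @ (- \<epsilon>) # q" by (meson split_list)
        have rot': "rotation cs (- \<epsilon> # q @ \<epsilon> # p)"
        proof (rule rotation_trans[OF rot])
          show "rotation (\<epsilon> # zs) (- \<epsilon> # q @ \<epsilon> # p)"
            unfolding rotation_def pq by (intro exI[of _ "\<epsilon> # p"] exI[of _ "- \<epsilon> # q"]) simp
        qed
        have neg': "\<forall>c\<in>set p \<union> set q. \<epsilon> * c < 0" using neg pq by auto
        have "2 \<le> length (q @ \<epsilon> # p)" using 3(1) rotation_length[OF rot'] by simp
        then obtain a' ys' b' where q: "q @ \<epsilon> # p = a' # ys' @ [b']"
          using list_two_ends by blast
        obtain \<delta>' where d': "\<delta>' \<in> {1, - 1}" "\<forall>c\<in>set (contract (- \<epsilon>) a' ys' b'). 0 < \<delta>' * c"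
        proof -
          have "- \<epsilon> \<in> {1, - 1}" using e by auto
          from contraction[OF this, of a' ys' b'] show ?thesis using rot' that unfolding q by blast
        qed
        \<comment> \<open>The entry \<open>\<epsilon>\<close> keeps its sign, whereas another neighbour of \<open>- \<epsilon>\<close> does not get that sign.\<close>
        have "\<epsilon> \<in> set (a' # ys' @ [b'])" unfolding q[symmetric] by simp
        then have "\<exists>c\<in>set (contract (- \<epsilon>) a' ys' b'). 0 < \<epsilon> * c"
        proof -
          from \<open>\<epsilon> \<in> set (a' # ys' @ [b'])\<close> have "a' = \<epsilon> \<or> b' = \<epsilon> \<or> \<epsilon> \<in> set ys'" by auto
          then have "2 * \<epsilon> \<in> set (contract (- \<epsilon>) a' ys' b') \<or> \<epsilon> \<in> set (contract (- \<epsilon>) a' ys' b')"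
            by (auto simp: contract_def)
          moreover have "0 < \<epsilon> * (2 * \<epsilon>)" "0 < \<epsilon> * \<epsilon>" using e by auto
          ultimately show ?thesis by blast
        qed
        then have "\<delta>' = \<epsilon>" using d' e by (auto simp: zero_less_mult_iff)
        moreover have "\<epsilon> * a' < 0 \<or> \<epsilon> * b' < 0"
        proof (cases q)
          case Nil
          then have "p = ys' @ [b']" using q by auto
          then show ?thesis using neg' by auto
        next
          case (Cons c q')
          then show ?thesis using q neg' by auto
        qed
        moreover have "a' + \<epsilon> \<in> set (contract (- \<epsilon>) a' ys' b')" "b' + \<epsilon> \<in> set (contract (- \<epsilon>) a' ys' b')"
          by (auto simp: contract_def)
        ultimately have "0 < \<epsilon> * (a' + \<epsilon>)" "0 < \<epsilon> * (b' + \<epsilon>)" "\<epsilon> * a' < 0 \<or> \<epsilon> * b' < 0"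
          using d' by auto
        then show False using e by auto
      next
        case no: False
        have "\<bar>c\<bar> \<noteq> 1" if "c \<in> set zs" for c
          using neg no that e by (auto simp: abs_if split: if_splits)
        then have big: "\<forall>c\<in>set zs. \<epsilon> * c \<le> - 2"
          using neg e by (fastforce simp: abs_if)
        have c2: "\<forall>c\<in>set (contract \<epsilon> a ys b). 2 \<le> \<bar>c\<bar>"
          using big e unfolding zs contract_def by (auto simp: algebra_simps)
        have "\<bar>tr (word (contract \<epsilon> a ys b))\<bar> \<le> 2"
          using contract_tr[OF e, of a ys b] rotation_tr[OF rot] less.prems(3) e zs by auto
        then obtain \<eta> where eta: "\<eta> \<in> {1, - 1}" "\<forall>c\<in>set (contract \<epsilon> a ys b). c = 2 * \<eta>"
          using small_trace_large_letters[OF _ c2] by (auto simp: contract_def)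
        then have "a - \<epsilon> = 2 * \<eta>" by (simp add: contract_def)
        moreover have "\<epsilon> * a \<le> - 2" using big zs by simp
        ultimately show False using e eta(1) by auto
      qed
      then show ?thesis ..
    qed
  qed
qed

section \<open>Frieze patterns\<close>

definition window :: "(nat \<Rightarrow> int) \<Rightarrow> nat \<Rightarrow> nat \<Rightarrow> int list" where
  "window c t i = map c [t..<t + i]"

lemma window_simps:
  "window c t 0 = []" "window c t (Suc i) = c t # window c (Suc t) i"
  "window c t (Suc i) = window c t i @ [c (t + i)]"
  subgoal by (simp add: window_def)
  subgoal using upt_conv_Cons[of t "t + Suc i"] by (simp add: window_def del: upt_Suc)
  subgoal by (simp add: window_def)
  done

lemma window_add: "window c t (i + j) = window c t i @ window c (t + i) j"
  unfolding window_def by (metis add.assoc le_add1 map_append upt_add_eq_append)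

lemma length_window [simp]: "length (window c t i) = i"
  by (simp add: window_def)

text \<open>The relation between neighbouring entries is the determinant identity
\<open>continuant_Cons_snoc\<close>. As entries can be cancelled, the entry \<open>a i t\<close> is the continuant
of the word \<open>c\<^sub>t \<dots> c\<^bsub>t+i-1\<^esub>\<close> in the first row. The relation in the last row
is the same identity with \<open>a (k - 1) (t + 1) + \<tau>\<close> in place of the next row. Expanding the
continuants of length \<open>k + 1\<close> at either end then gives the period \<open>k + 1\<close>, and their
difference from the continuants of the inner words is the trace \<open>\<tau>\<close>. Finally the signs of the
first row determine all others, because a product of two non-zero integers of the same sign is at least 1.\<close>

theorem frieze_pattern_signs:
  fixes a :: "nat \<Rightarrow> nat \<Rightarrow> int" and \<tau> :: int
  assumes k: "1 \<le> k" and tau: "\<bar>\<tau>\<bar> \<le> 2"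
    and a0: "\<And>t. a 0 t = 1"
    and nz: "\<And>i t. 1 \<le> i \<Longrightarrow> i \<le> k \<Longrightarrow> a i t \<noteq> 0"
    and mesh: "\<And>i t. 1 \<le> i \<Longrightarrow> i < k \<Longrightarrow> a i t * a i (Suc t) = 1 + a (i - 1) (Suc t) * a (i + 1) t"
    and last: "\<And>t. a k t * a k (Suc t) = 1 + a (k - 1) (Suc t) * (a (k - 1) (Suc t) + \<tau>)"
  shows "\<exists>\<epsilon>\<in>{1, - 1}. (\<forall>i\<le>k. \<forall>t. 0 < \<epsilon> ^ i * a i t) \<and> - 2 < \<epsilon> ^ (k + 1) * \<tau>"
proof -
  define c where "c t = a 1 t" for t
  \<comment> \<open>Row \<open>k + 1\<close> is chosen such that the relation holds in row \<open>k\<close> as well.\<close>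
  define A where "A i t = (if i = k + 1 then a (k - 1) (Suc t) + \<tau> else a i t)" for i t
  have A0: "A 0 t = 1" and A_le: "i \<le> k \<Longrightarrow> A i t = a i t" for i t using a0 by (simp_all add: A_def)
  have meshA: "A (i + 1) t * A (i - 1) (Suc t) = A i t * A i (Suc t) - 1" if "1 \<le> i" "i \<le> k" for i t
  proof (cases "i = k")
    case True
    moreover have "k - 1 \<noteq> k + 1" by simp
    ultimately show ?thesis using last[of t] by (simp add: A_def)
  next
    case False
    moreover have "i - 1 \<noteq> k + 1" using that by simp
    ultimately show ?thesis using mesh[of i t] that by (simp add: A_def)
  qed
  have A_nz: "A i t \<noteq> 0" if "i \<le> k" for i t
    using nz[of i t] a0[of t] A_le that by (cases i) auto
  have K: "continuant (window c t i) = A i t" if "i \<le> k + 1" for i t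
    using that
  proof (induction i arbitrary: t rule: less_induct)
    case (less i)
    consider "i = 0" | "i = 1" | j where "i = Suc (Suc j)"
      by (metis One_nat_def not0_implies_Suc)
    then show ?case
    proof cases
      case 1
      then show ?thesis using A0 by (simp add: window_simps)
    next
      case 2
      then show ?thesis using k by (simp add: window_simps c_def A_def)
    next
      case (3 j)
      let ?w = "window c (Suc t) j"
      have "continuant (window c t i) * continuant ?w
          = continuant (window c t (Suc j)) * continuant (window c (Suc t) (Suc j)) - 1"
        using continuant_Cons_snoc[of "c t" ?w "c (Suc t + j)"]
        unfolding 3 by (simp add: window_simps(2)[of c t] window_simps(3)[of c "Suc t"])
      also have "\<dots> = A (Suc j) t * A (Suc j) (Suc t) - 1"
        using less 3 by simp
      also have "\<dots> = A i t * A j (Suc t)"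
        using meshA[of "Suc j" t] less.prems 3 by simp
      finally show ?thesis
        using A_nz[of j "Suc t"] less 3 by simp
    qed
  qed
  obtain m where m: "k = Suc m" using k by (cases k) auto
  have AN: "A (k + 1) t = A (k - 1) (Suc t) + \<tau>" for t
  proof -
    have "k - 1 \<noteq> k + 1" by simp
    then show ?thesis by (simp only: A_def refl if_True if_False)
  qed
  have period: "c (t + (k + 1)) = c t" for t
  proof -
    let ?w = "window c (Suc (Suc t)) m"
    \<comment> \<open>Expand two consecutive continuants of length \<open>k + 1\<close>, one at its start and one at its end.\<close>
    have "A (k + 1) t = c t * A k (Suc t) - A (k - 1) (Suc (Suc t))"
      using continuant_Cons_Cons[of "c t" "c (Suc t)" ?w] K[of "k + 1" t] K[of k "Suc t"]
        K[of "k - 1" "Suc (Suc t)"]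
      by (simp add: m window_simps(2))
    moreover have "A (k + 1) (Suc t) = A k (Suc t) * c (t + (k + 1)) - A (k - 1) (Suc t)"
      using continuant_snoc_snoc[of "window c (Suc t) m" "c (Suc t + m)" "c (Suc t + k)"]
        K[of "k + 1" "Suc t"] K[of k "Suc t"] K[of "k - 1" "Suc t"]
      by (simp add: m window_simps(3))
    ultimately have "A k (Suc t) * c (t + (k + 1)) = c t * A k (Suc t)"
      using AN[of t] AN[of "Suc t"] by linarith
    then show ?thesis using A_nz[of k "Suc t"] by simp
  qed
  let ?cs = "window c 0 (k + 1)"
  have shift: "window c (t + (k + 1)) i = window c t i" for t i
  proof (induction i)
    case (Suc i)
    have "t + (k + 1) + i = t + i + (k + 1)" by simp
    then have "c (t + (k + 1) + i) = c (t + i)" by (simp only: period)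
    then show ?case by (simp only: window_simps(3) Suc)
  qed (simp add: window_simps(1))
  have "nondegenerate ?cs"
    unfolding nondegenerate_def
  proof (intro allI impI)
    fix w z
    assume "rotation ?cs (w @ z)" "w \<noteq> []" "z \<noteq> []"
    then obtain p q where pq: "?cs = p @ q" "w @ z = q @ p" unfolding rotation_def by auto
    define n l where "n = length p" and "l = length w"
    have len: "length p + length q = k + 1" using pq(1) by (metis length_append length_window)
    have len': "length w + length z = k + 1"
      using len arg_cong[OF pq(2), of length] by simp
    have "?cs = window c 0 n @ window c n (length q)"
      using window_add[of c 0 n "length q"] len by (simp add: n_def)
    then have p: "p = window c 0 n" and q: "q = window c n (length q)"
      using pq(1) by (auto simp: n_def append_eq_append_conv)
    have "w @ z = window c n (length q) @ window c (0 + (k + 1)) n"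
      using pq(2) p q shift by metis
    also have "\<dots> = window c n (k + 1)"
      using window_add[of c n "length q" n] len by (simp add: n_def add.commute)
    also have "\<dots> = window c n l @ window c (n + l) (length z)"
      using window_add[of c n l "length z"] len' by (simp add: l_def)
    finally have "w = window c n l" by (auto simp: l_def append_eq_append_conv)
    moreover have "l \<le> k" using len' \<open>z \<noteq> []\<close> by (cases z) (auto simp: l_def)
    ultimately show "continuant w \<noteq> 0" using K[of l n] A_nz by simp
  qed
  moreover have tr_cs: "tr (word ?cs) = \<tau>"
  proof -
    have "tr (word ?cs) = continuant ?cs - continuant (window c (Suc 0) m)"
      using tr_word_Cons_snoc[of "c 0" "window c (Suc 0) m" "c (Suc 0 + m)"]
      by (simp add: m window_simps(2)[of c 0] window_simps(3)[of c "Suc 0"])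
    then show ?thesis using K[of "k + 1" 0] K[of m "Suc 0"] AN[of 0] m by simp
  qed
  moreover have "2 \<le> length ?cs" using k by simp
  ultimately obtain \<epsilon> where e: "\<epsilon> \<in> {1, - 1}" and pos: "\<forall>x\<in>set ?cs. 0 < \<epsilon> * x"
    and tre: "- 2 < \<epsilon> ^ (k + 1) * \<tau>"
    using nondegenerate_same_sign[of ?cs] tau unfolding tr_cs length_window by blast
  have c_pos: "0 < \<epsilon> * c t" for t
  proof (induction t rule: less_induct)
    case (less t)
    show ?case
    proof (cases "t < k + 1")
      case True
      then have "c t \<in> set ?cs" by (auto simp: window_def simp del: upt_Suc)
      then show ?thesis using pos by blast
    next
      case False
      then have "c t = c (t - (k + 1))" using period[of "t - (k + 1)"] by simp
      then show ?thesis using less[of "t - (k + 1)"] False by simp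
    qed
  qed
  have "0 < \<epsilon> ^ i * a i t" if "i \<le> k" for i t
    using that
  proof (induction i arbitrary: t rule: less_induct)
    case (less i)
    consider "i = 0" | "i = 1" | j where "i = Suc (Suc j)"
      by (metis One_nat_def not0_implies_Suc)
    then show ?case
    proof cases
      case 1
      then show ?thesis using a0 by simp
    next
      case 2
      then show ?thesis using c_pos[of t] by (simp add: c_def)
    next
      case (3 j)
      have ee: "(\<epsilon> ^ n) * (\<epsilon> ^ n) = 1" for n
        using e by (auto simp flip: power_add mult_2)
      let ?P = "\<epsilon> ^ j * a j (Suc t)" and ?Q = "\<epsilon> ^ i * a i t"
      have "(\<epsilon> ^ Suc j * a (Suc j) t) * (\<epsilon> ^ Suc j * a (Suc j) (Suc t)) = 1 + ?P * ?Q"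
      proof -
        have "(\<epsilon> ^ Suc j * a (Suc j) t) * (\<epsilon> ^ Suc j * a (Suc j) (Suc t))
            = (\<epsilon> ^ Suc j * \<epsilon> ^ Suc j) * (a (Suc j) t * a (Suc j) (Suc t))"
          by (simp only: mult_ac)
        also have "\<dots> = 1 + a j (Suc t) * a i t"
          using mesh[of "Suc j" t] less.prems 3 ee[of "Suc j"] by simp
        also have "\<dots> = 1 + (\<epsilon> ^ Suc j * \<epsilon> ^ Suc j) * (a j (Suc t) * a i t)"
          using ee[of "Suc j"] by simp
        also have "\<dots> = 1 + ?P * ?Q" by (simp add: 3 algebra_simps)
        finally show ?thesis .
      qed
      moreover have "0 < (\<epsilon> ^ Suc j * a (Suc j) t) * (\<epsilon> ^ Suc j * a (Suc j) (Suc t))"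
      proof (rule mult_pos_pos)
        have "Suc j < i" "Suc j \<le> k" using less.prems 3 by auto
        then show "0 < \<epsilon> ^ Suc j * a (Suc j) t" "0 < \<epsilon> ^ Suc j * a (Suc j) (Suc t)"
          by (rule less.IH)+
      qed
      ultimately have "0 \<le> ?P * ?Q" by linarith
      moreover have "0 < ?P" using less.IH[of j "Suc t"] less.prems 3 by simp
      moreover have "?Q \<noteq> 0" using nz[of i t] less.prems 3 e by auto
      ultimately show ?thesis by (smt (verit) mult_pos_neg)
    qed
  qed
  then show ?thesis using e tre by blast
qed

section \<open>Changing signs of indeterminates\<close>

definition mon_degree :: "(nat \<Rightarrow> nat) \<Rightarrow> (nat \<Rightarrow>\<^sub>0 nat) \<Rightarrow> nat" where
  "mon_degree d m = (\<Sum>i\<in>Poly_Mapping.keys m. d i * Poly_Mapping.lookup m i)"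

text \<open>The substitution \<open>x\<^sub>i \<mapsto> (-1)\<^bsup>d i\<^esup> x\<^sub>i\<close>, which is
diagonal on monomials.\<close>

definition poly_twist :: "(nat \<Rightarrow> nat) \<Rightarrow> ((nat \<Rightarrow>\<^sub>0 nat) \<Rightarrow>\<^sub>0 int) \<Rightarrow> ((nat \<Rightarrow>\<^sub>0 nat) \<Rightarrow>\<^sub>0 int)" where
  "poly_twist d = frag_extend (\<lambda>m. frag_cmul ((- 1) ^ mon_degree d m) (frag_of m))"

lemma mon_degree_add: "mon_degree d (m + n) = mon_degree d m + mon_degree d n"
  unfolding mon_degree_def by (rule setsum_keys_plus_distrib) (simp_all add: distrib_left)

lemma frag_cmul_mult:
  fixes m n :: "nat \<Rightarrow>\<^sub>0 nat"
  shows "frag_cmul a (frag_of m) * frag_cmul b (frag_of n) = frag_cmul (a * b) (frag_of (m + n))"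
proof -
  have "frag_cmul c (frag_of l) = Poly_Mapping.single l c" for c and l :: "nat \<Rightarrow>\<^sub>0 nat"
    by (rule poly_mapping_eqI) (simp add: lookup_single when_def)
  then show ?thesis by (simp add: mult_single)
qed

lemma poly_twist_of: "poly_twist d (frag_of m) = frag_cmul ((- 1) ^ mon_degree d m) (frag_of m)"
  by (simp add: poly_twist_def)

lemma poly_twist_0 [simp]: "poly_twist d 0 = 0"
  by (simp add: poly_twist_def)

lemma poly_twist_diff: "poly_twist d (p - q) = poly_twist d p - poly_twist d q"
  by (simp add: poly_twist_def frag_extend_diff)

lemma poly_twist_add: "poly_twist d (p + q) = poly_twist d p + poly_twist d q"
  by (simp add: poly_twist_def frag_extend_add)

lemma poly_twist_mult: "poly_twist d (p * q) = poly_twist d p * poly_twist d q"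
proof (rule frag_induction[of p UNIV])
  fix m
  show "poly_twist d (frag_of m * q) = poly_twist d (frag_of m) * poly_twist d q"
  proof (rule frag_induction[of q UNIV])
    fix n
    have "frag_of m * frag_of n = (frag_of (m + n) :: (nat \<Rightarrow>\<^sub>0 nat) \<Rightarrow>\<^sub>0 int)"
      by (simp add: mult_single)
    then show "poly_twist d (frag_of m * frag_of n) = poly_twist d (frag_of m) * poly_twist d (frag_of n)"
      by (simp add: poly_twist_of frag_cmul_mult mon_degree_add power_add)
  qed (simp_all add: poly_twist_diff right_diff_distrib)
qed (simp_all add: poly_twist_diff left_diff_distrib)

lemma poly_twist_1 [simp]: "poly_twist d 1 = 1"
proof -
  have "poly_twist d (frag_of 0) = frag_of 0"
    by (subst poly_twist_of) (simp add: mon_degree_def)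
  then show ?thesis by simp
qed

lemma poly_twist_twist [simp]: "poly_twist d (poly_twist d p) = p"
proof (rule frag_induction[of p UNIV])
  fix m
  have "(- 1) ^ n * (- 1) ^ n = (1 :: int)" for n :: nat
    by (simp flip: power_mult_distrib)
  then show "poly_twist d (poly_twist d (frag_of m)) = frag_of m"
    unfolding poly_twist_def by (simp add: frag_extend_cmul)
qed (simp_all add: poly_twist_diff)

lemma poly_twist_eq_0_iff [simp]: "poly_twist d p = 0 \<longleftrightarrow> p = 0"
  by (metis poly_twist_0 poly_twist_twist)

lift_definition twist :: "(nat \<Rightarrow> nat) \<Rightarrow> ratfun \<Rightarrow> ratfun" is
  "\<lambda>d q. (poly_twist d (fst q), poly_twist d (snd q))"
  by (simp flip: poly_twist_mult)

lemma twist_Fract: "b \<noteq> 0 \<Longrightarrow> twist d (Fract a b) = Fract (poly_twist d a) (poly_twist d b)"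
  by transfer simp

lemma twist_add: "twist d (x + y) = twist d x + twist d y"
  by (cases x; cases y) (simp add: twist_Fract poly_twist_add poly_twist_mult)

lemma twist_mult: "twist d (x * y) = twist d x * twist d y"
  by (cases x; cases y) (simp add: twist_Fract poly_twist_mult)

lemma twist_1 [simp]: "twist d 1 = 1"
  by (simp add: One_fract_def twist_Fract)

lemma twist_twist [simp]: "twist d (twist d x) = x"
  by (cases x) (simp add: twist_Fract)

lemma twist_var: "twist d (var i) = (- 1) ^ d i * var i"
proof -
  have deg: "mon_degree d (Poly_Mapping.single i 1) = d i"
    by (simp add: mon_degree_def)
  have "twist d (var i) = Fract (frag_cmul ((- 1) ^ d i) (frag_of (Poly_Mapping.single i 1))) 1"
    unfolding var_def by (subst twist_Fract) (simp_all only: poly_twist_of deg poly_twist_1, simp)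
  then show ?thesis by (cases "even (d i)") (simp_all add: var_def)
qed

lemma twist_0 [simp]: "twist d 0 = 0"
  by (simp add: Zero_fract_def twist_Fract)

lemma twist_minus: "twist d (- x) = - twist d x"
  using twist_add[of d x "- x"] by (simp add: eq_neg_iff_add_eq_0 add.commute)

lemma twist_diff: "twist d (x - y) = twist d x - twist d y"
  using twist_add[of d x "- y"] by (simp add: twist_minus)

lemma twist_prod: "twist d (\<Prod>i\<in>A. g i) = (\<Prod>i\<in>A. twist d (g i))"
  by (induction A rule: infinite_finite_induct) (simp_all add: twist_mult)

lemma twist_power: "twist d (x ^ n) = twist d x ^ n"
  by (induction n) (simp_all add: twist_mult)

lemma twist_divide: "twist d (x / y) = twist d x / twist d y"
proof (cases "y = 0")
  case False
  then have "twist d y \<noteq> 0" by (metis twist_0 twist_twist)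
  moreover have "twist d (x / y) * twist d y = twist d x" using False by (simp flip: twist_mult)
  ultimately show ?thesis by (simp add: nonzero_eq_divide_eq)
qed simp

section \<open>Friezes on seeds\<close>

lemma is_subring_cluster_algebra: "is_subring (cluster_algebra V B)"
  unfolding cluster_algebra_def by (rule hull_in) (auto simp: is_subring_def)

lemma cluster_variables_subset: "cluster_variables V B \<subseteq> cluster_algebra V B"
  unfolding cluster_algebra_def by (rule hull_subset)

lemma seed_cluster_variable: "seed V B0 B x \<Longrightarrow> i \<in> V \<Longrightarrow> x i \<in> cluster_variables V B0"
  unfolding cluster_variables_def by blast

lemma subring_closed:
  assumes "is_subring R"
  shows subring_0: "0 \<in> R" and subring_1: "1 \<in> R"
    and subring_minus: "a \<in> R \<Longrightarrow> - a \<in> R"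
    and subring_add: "a \<in> R \<Longrightarrow> b \<in> R \<Longrightarrow> a + b \<in> R"
    and subring_mult: "a \<in> R \<Longrightarrow> b \<in> R \<Longrightarrow> a * b \<in> R"
proof -
  show 1: "1 \<in> R" using assms by (simp add: is_subring_def)
  then show 0: "0 \<in> R" using assms unfolding is_subring_def by (metis diff_self)
  then show m: "- a \<in> R" if "a \<in> R" for a using assms that unfolding is_subring_def by (metis diff_0)
  show "a \<in> R \<Longrightarrow> b \<in> R \<Longrightarrow> a + b \<in> R"
    using assms m unfolding is_subring_def by (metis diff_minus_eq_add)
  show "a \<in> R \<Longrightarrow> b \<in> R \<Longrightarrow> a * b \<in> R"
    using assms by (simp add: is_subring_def)
qed

lemma ring_homs_simps:
  assumes f: "f \<in> ring_homs R"
  shows hom_1: "f 1 = 1"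
    and hom_add: "a \<in> R \<Longrightarrow> b \<in> R \<Longrightarrow> f (a + b) = f a + f b"
    and hom_mult: "a \<in> R \<Longrightarrow> b \<in> R \<Longrightarrow> f (a * b) = f a * f b"
  using f by (auto simp: ring_homs_def)

lemma hom_0:
  assumes "f \<in> ring_homs R" "is_subring R"
  shows "f 0 = 0"
  using hom_add[OF assms(1), of 0 0] subring_0[OF assms(2)] by simp

lemma hom_minus:
  assumes "f \<in> ring_homs R" "is_subring R" "a \<in> R"
  shows "f (- a) = - f a"
  using hom_add[OF assms(1), of a "- a"] subring_minus[OF assms(2)] hom_0[OF assms(1,2)] assms(3) by simp

lemma hom_power:
  assumes "f \<in> ring_homs R" "is_subring R" "a \<in> R"
  shows "a ^ n \<in> R \<and> f (a ^ n) = f a ^ n"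
  by (induction n) (use assms in \<open>auto simp: subring_1 subring_mult hom_1 hom_mult\<close>)

lemma hom_prod:
  assumes "f \<in> ring_homs R" "is_subring R" "\<And>i. i \<in> A \<Longrightarrow> g i \<in> R"
  shows "(\<Prod>i\<in>A. g i) \<in> R \<and> f (\<Prod>i\<in>A. g i) = (\<Prod>i\<in>A. f (g i))"
  using assms(3)
proof (induction A rule: infinite_finite_induct)
  case (infinite A)
  then show ?case using assms by (simp add: subring_1 hom_1)
next
  case empty
  then show ?case using assms by (simp add: subring_1 hom_1)
next
  case (insert i A)
  then show ?case using assms by (auto simp: subring_mult hom_mult)
qed

lemma nonzero_frieze_hom: "f \<in> nonzero_friezes V B \<Longrightarrow> f \<in> ring_homs (cluster_algebra V B)"
  by (simp add: nonzero_friezes_def)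

lemma nonzero_frieze_seed: "f \<in> nonzero_friezes V B0 \<Longrightarrow> seed V B0 B x \<Longrightarrow> i \<in> V \<Longrightarrow> f (x i) \<noteq> 0"
  using seed_cluster_variable by (simp add: nonzero_friezes_def)

lemma prod_filter_exponent:
  fixes y :: "nat \<Rightarrow> 'a::comm_semiring_1"
  assumes "finite V"
  shows "(\<Prod>i\<in>{i \<in> V. 0 < b i}. y i ^ nat (b i)) = (\<Prod>i\<in>V. y i ^ nat (b i))"
    "(\<Prod>i\<in>{i \<in> V. b i < 0}. y i ^ nat (- b i)) = (\<Prod>i\<in>V. y i ^ nat (- b i))"
  by (rule prod.mono_neutral_left, use assms in simp, blast, simp add: not_less)+

lemma mutate_cluster_at:
  assumes "finite V"
  shows "mutate_cluster V k B x k = ((\<Prod>i\<in>V. x i ^ nat (B i k)) + (\<Prod>i\<in>V. x i ^ nat (- B i k))) / x k"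
  using prod_filter_exponent[OF assms, of x "\<lambda>i. B i k"] by (simp add: mutate_cluster_def)

lemma mutate_cluster_other [simp]: "i \<noteq> k \<Longrightarrow> mutate_cluster V k B x i = x i"
  by (simp add: mutate_cluster_def)

text \<open>The exchange relation holds in the field of fractions as \<open>x\<^sub>k \<noteq> 0\<close>, and this
follows from the non-zero value of the frieze at \<open>x\<^sub>k\<close>.\<close>

lemma exchange_value:
  assumes fin: "finite V" and f: "f \<in> nonzero_friezes V B0" and s: "seed V B0 B x" and k: "k \<in> V"
  shows "f (x k) * f (mutate_cluster V k B x k)
    = (\<Prod>i\<in>V. f (x i) ^ nat (B i k)) + (\<Prod>i\<in>V. f (x i) ^ nat (- B i k))"
proof -
  let ?R = "cluster_algebra V B0" and ?y = "mutate_cluster V k B x k"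
  note hom = nonzero_frieze_hom[OF f] and sub = is_subring_cluster_algebra[of V B0]
  have xR: "x i \<in> ?R" if "i \<in> V" for i
    using seed_cluster_variable[OF s that] cluster_variables_subset by blast
  have yR: "?y \<in> ?R"
    using seed_cluster_variable[OF mutation[OF s k] k] cluster_variables_subset by blast
  have "x k \<noteq> 0" using nonzero_frieze_seed[OF f s k] hom_0[OF hom sub] by metis
  then have "x k * ?y = (\<Prod>i\<in>V. x i ^ nat (B i k)) + (\<Prod>i\<in>V. x i ^ nat (- B i k))"
    using mutate_cluster_at[OF fin, of k B x] by simp
  then have "f (x k) * f ?y = f ((\<Prod>i\<in>V. x i ^ nat (B i k)) + (\<Prod>i\<in>V. x i ^ nat (- B i k)))"
    using hom_mult[OF hom xR[OF k] yR] by simp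
  moreover have "(\<Prod>i\<in>V. x i ^ n i) \<in> ?R \<and> f (\<Prod>i\<in>V. x i ^ n i) = (\<Prod>i\<in>V. f (x i) ^ n i)" for n
    using hom_prod[OF hom sub, of V "\<lambda>i. x i ^ n i"] hom_power[OF hom sub xR] by auto
  ultimately show ?thesis using hom_add[OF hom] by simp
qed

lemma positive_of_initial:
  assumes fin: "finite V" and f: "f \<in> nonzero_friezes V B0" and init: "\<forall>i\<in>V. 0 < f (var i)"
  shows "f \<in> positive_friezes V B0"
proof -
  have pos: "\<forall>i\<in>V. 0 < f (x i)" if "seed V B0 B x" for B x
    using that
  proof (induction rule: seed.induct)
    case initial
    then show ?case using init .
  next
    case (mutation B x k)
    have "0 < f (x k) * f (mutate_cluster V k B x k)"
      unfolding exchange_value[OF fin f mutation(1,2)]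
      by (intro add_pos_pos prod_pos zero_less_power) (use mutation in auto)
    then have "0 < f (mutate_cluster V k B x k)"
      using mutation by (metis zero_less_mult_pos)
    then show ?case using mutation by (metis mutate_cluster_other)
  qed
  have "\<forall>x\<in>cluster_variables V B0. 0 < f x"
    using pos unfolding cluster_variables_def by blast
  then show ?thesis using f by (simp add: nonzero_friezes_def positive_friezes_def)
qed

section \<open>Parity gradings\<close>

text \<open>Skew-symmetrizability with explicit symmetrizer. It makes the diagonal vanish after any number of
mutations, so that \<open>x\<^sub>k\<close> does not occur in its own exchange monomials.\<close>

definition skew_by :: "(nat \<Rightarrow> int) \<Rightarrow> nat set \<Rightarrow> exchange_matrix \<Rightarrow> bool" where
  "skew_by D V B \<longleftrightarrow> (\<forall>i\<in>V. 0 < D i) \<and> (\<forall>i\<in>V. \<forall>j\<in>V. D i * B i j = - (D j * B j i))"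

text \<open>For degrees \<open>d\<close> in the integers mod 2, both monomials in the exchange relation at
\<open>j\<close> have the same degree.\<close>

definition parity_grading :: "(nat \<Rightarrow> nat) \<Rightarrow> nat set \<Rightarrow> exchange_matrix \<Rightarrow> bool" where
  "parity_grading d V B \<longleftrightarrow> (\<forall>j\<in>V. even (\<Sum>i\<in>V. int (d i) * B i j))"

lemma skew_by_signs:
  assumes "skew_by D V B" "i \<in> V" "j \<in> V"
  shows "0 < B i j \<longleftrightarrow> B j i < 0"
proof -
  have "0 < D i" "0 < D j" "D i * B i j = - (D j * B j i)"
    using assms unfolding skew_by_def by blast+
  then show ?thesis by (smt (verit) mult_pos_pos mult_pos_neg zero_less_mult_pos mult_less_0_iff)
qed

lemma skew_by_diag: "skew_by D V B \<Longrightarrow> i \<in> V \<Longrightarrow> B i i = 0"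
  using skew_by_signs[of D V B i i] by force

text \<open>The correction in the mutation rule is a multiple of \<open>b\<close> whose factor is the exponent of
the indeterminate in one of the two exchange monomials. So the corrections in a column, weighted with the degrees,
sum up to \<open>b\<close> times the degree of an exchange monomial.\<close>

lemma mutation_term:
  fixes a b :: int
  shows "sgn a * max 0 (a * b) = (if 0 < b then max 0 a * b else max 0 (- a) * b)"
proof (cases "a = 0 \<or> b = 0")
  case False
  then consider "0 < a" "0 < b" | "0 < a" "b < 0" | "a < 0" "0 < b" | "a < 0" "b < 0" by linarith
  then show ?thesis
  proof cases
    case 1
    then have "0 < a * b" by simp
    then show ?thesis using 1 by simp
  next
    case 2
    then have "a * b < 0" by (simp add: mult_pos_neg)
    then show ?thesis using 2 by simp
  next
    case 3
    then have "a * b < 0" by (simp add: mult_neg_pos)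
    then show ?thesis using 3 by simp
  next
    case 4
    then have "0 < a * b" by (simp add: mult_neg_neg)
    then show ?thesis using 4 by simp
  qed
qed auto

lemma mutate_matrix_skew:
  assumes skew: "skew_by D V B" and k: "k \<in> V"
  shows "skew_by D V (mutate_matrix k B)"
  unfolding skew_by_def
proof (intro conjI ballI)
  show "0 < D i" if "i \<in> V" for i using skew that unfolding skew_by_def by blast
  fix i j assume i: "i \<in> V" and j: "j \<in> V"
  have S: "D a * B a b = - (D b * B b a)" if "a \<in> V" "b \<in> V" for a b
    using skew that unfolding skew_by_def by blast
  show "D i * mutate_matrix k B i j = - (D j * mutate_matrix k B j i)"
  proof (cases "i = k \<or> j = k")
    case True
    then have "mutate_matrix k B i j = - B i j" "mutate_matrix k B j i = - B j i"
      by (auto simp: mutate_matrix_def)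
    then show ?thesis using S[OF i j] by (metis mult_minus_right)
  next
    case False
    have *: "D i * (B i k * B k j) = D j * (B j k * B k i)"
    proof -
      have "D i * (B i k * B k j) = (D i * B i k) * B k j" by simp
      also have "\<dots> = - (D k * B k j) * B k i" unfolding S[OF i k] by simp
      also have "\<dots> = D j * (B j k * B k i)" unfolding S[OF k j] by simp
      finally show ?thesis .
    qed
    have "D i * (sgn (B i k) * max 0 (B i k * B k j)) = - (D j * (sgn (B j k) * max 0 (B j k * B k i)))"
    proof -
      have s1: "0 < B i k \<longleftrightarrow> B k i < 0" "B i k < 0 \<longleftrightarrow> 0 < B k i"
        "0 < B k j \<longleftrightarrow> B j k < 0" "B k j < 0 \<longleftrightarrow> 0 < B j k"
        using skew_by_signs[OF skew i k] skew_by_signs[OF skew k i]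
          skew_by_signs[OF skew j k] skew_by_signs[OF skew k j] by simp_all
      have pos: "0 < B i k * B k j \<longleftrightarrow> 0 < B j k * B k i"
        unfolding zero_less_mult_iff s1 by blast
      show ?thesis
      proof (cases "0 < B i k * B k j")
        case True
        then have max: "max 0 (B i k * B k j) = B i k * B k j" "max 0 (B j k * B k i) = B j k * B k i"
          using pos by (simp_all only: max_def order.strict_implies_order if_True)
        have "sgn (B j k) = - sgn (B i k)"
          using True s1 by (auto simp: zero_less_mult_iff)
        moreover have "D i * (sgn (B i k) * (B i k * B k j)) = sgn (B i k) * (D j * (B j k * B k i))"
          unfolding *[symmetric] by (simp only: mult.left_commute)
        ultimately show ?thesis unfolding max by (simp add: mult.left_commute)
      next
        case False
        then have max: "max 0 (B i k * B k j) = 0" "max 0 (B j k * B k i) = 0"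
          using pos by (simp_all add: not_less max_absorb1)
        show ?thesis unfolding max by simp
      qed
    qed
    moreover have "mutate_matrix k B i j = B i j + sgn (B i k) * max 0 (B i k * B k j)"
      "mutate_matrix k B j i = B j i + sgn (B j k) * max 0 (B j k * B k i)"
      using False by (simp_all add: mutate_matrix_def)
    ultimately show ?thesis using S[OF i j] by (simp only: distrib_left)
  qed
qed

lemma parity_grading_monomials:
  assumes "parity_grading d V B" "j \<in> V"
  shows "even (\<Sum>i\<in>V. int (d i) * max 0 (B i j)) \<longleftrightarrow> even (\<Sum>i\<in>V. int (d i) * max 0 (- B i j))"
proof -
  have "(\<Sum>i\<in>V. int (d i) * B i j) = (\<Sum>i\<in>V. int (d i) * max 0 (B i j)) - (\<Sum>i\<in>V. int (d i) * max 0 (- B i j))"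
    unfolding sum_subtractf[symmetric] by (intro sum.cong) (auto simp: max_def)
  moreover have "even (\<Sum>i\<in>V. int (d i) * B i j)"
    using assms unfolding parity_grading_def by blast
  ultimately show ?thesis by simp
qed

text \<open>The new variable has the degree of \<open>x\<^sub>k\<close> plus that of an exchange monomial at
\<open>k\<close>. In column \<open>j\<close> the second summand, multiplied by \<open>b\<^sub>k\<^sub>j\<close>, is
compensated mod 2 by the corrections to the other entries, as both monomials at \<open>k\<close> have the same
parity.\<close>

lemma mutate_parity_grading:
  assumes fin: "finite V" and skew: "skew_by D V B" and d: "parity_grading d V B" and k: "k \<in> V"
  shows "parity_grading (d(k := d k + (\<Sum>i\<in>V. d i * nat (B i k)))) V (mutate_matrix k B)"
  unfolding parity_grading_def
proof
  fix j assume j: "j \<in> V"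
  define p where "p = (\<Sum>i\<in>V. int (d i) * max 0 (B i k))"
  define q where "q = (\<Sum>i\<in>V. int (d i) * max 0 (- B i k))"
  have pq: "even p \<longleftrightarrow> even q" unfolding p_def q_def by (rule parity_grading_monomials[OF d k])
  have kk: "B k k = 0" using skew_by_diag[OF skew k] .
  have p_nat: "int (\<Sum>i\<in>V. d i * nat (B i k)) = p"
    unfolding p_def by (auto intro!: sum.cong simp: max_def)
  let ?d = "d(k := d k + (\<Sum>i\<in>V. d i * nat (B i k)))"
  have split: "(\<Sum>i\<in>V. g i) = g k + (\<Sum>i\<in>V - {k}. g i)" for g :: "nat \<Rightarrow> int"
    using fin k by (simp add: sum.remove)
  have base: "even (int (d k) * B k j + (\<Sum>i\<in>V - {k}. int (d i) * B i j))"
    using d j unfolding split[of "\<lambda>i. int (d i) * B i j", symmetric] parity_grading_def by blast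
  have "even (\<Sum>i\<in>V. int (?d i) * mutate_matrix k B i j)"
  proof (cases "j = k")
    case True
    have "(\<Sum>i\<in>V. int (?d i) * mutate_matrix k B i j) = - (\<Sum>i\<in>V - {k}. int (d i) * B i k)"
      unfolding split[of "\<lambda>i. int (?d i) * mutate_matrix k B i j"] using kk True
      by (simp add: mutate_matrix_def sum_negf)
    then show ?thesis using base True kk by simp
  next
    case False
    \<comment> \<open>By \<open>mutation_term\<close> it depends on the sign of \<open>B k j\<close> which monomial at \<open>k\<close> occurs.\<close>
    define r where "r = (if 0 < B k j then p else q)"
    have r: "even r \<longleftrightarrow> even p" using pq by (simp add: r_def)
    have r': "(\<Sum>i\<in>V - {k}. int (d i) * (sgn (B i k) * max 0 (B i k * B k j))) = r * B k j"
    proof -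
      have "(\<Sum>i\<in>V - {k}. int (d i) * (sgn (B i k) * max 0 (B i k * B k j)))
          = (\<Sum>i\<in>V. int (d i) * (sgn (B i k) * max 0 (B i k * B k j)))"
        using split[of "\<lambda>i. int (d i) * (sgn (B i k) * max 0 (B i k * B k j))"] kk by simp
      also have "\<dots> = r * B k j"
        unfolding mutation_term r_def p_def q_def by (simp add: sum_distrib_right mult.assoc)
      finally show ?thesis .
    qed
    have "(\<Sum>i\<in>V. int (?d i) * mutate_matrix k B i j)
        = (int (d k) + p) * (- B k j) + (\<Sum>i\<in>V - {k}. int (d i) * B i j) + r * B k j"
      unfolding split[of "\<lambda>i. int (?d i) * mutate_matrix k B i j"] r'[symmetric] add.assoc
        sum.distrib[symmetric] p_nat[symmetric]
      using False by (auto simp: mutate_matrix_def distrib_left intro!: sum.cong)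
    then show ?thesis using base r by (auto simp: distrib_right)
  qed
  then show "even (\<Sum>i\<in>V. int (?d i) * mutate_matrix k B i j)" .
qed

lemma twist_monomial:
  assumes "\<forall>i\<in>V. twist d (x i) = (- 1) ^ e i * x i"
  shows "twist d (\<Prod>i\<in>V. x i ^ n i) = (- 1) ^ (\<Sum>i\<in>V. e i * n i) * (\<Prod>i\<in>V. x i ^ n i)"
proof -
  have "twist d (\<Prod>i\<in>V. x i ^ n i) = (\<Prod>i\<in>V. (- 1) ^ (e i * n i) * x i ^ n i)"
    unfolding twist_prod twist_power using assms
    by (intro prod.cong) (simp_all add: power_mult_distrib power_mult)
  then show ?thesis by (simp add: prod.distrib power_sum)
qed

text \<open>All clusters are homogeneous for the grading of the initial one: a new cluster variable is a quotient
of homogeneous elements, as both exchange monomials have the same degree.\<close>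

lemma twist_seed:
  assumes fin: "finite V" and skew: "skew_by D V B0" and d: "parity_grading d V B0"
    and s: "seed V B0 B x"
  shows "skew_by D V B \<and> (\<exists>e. (\<forall>i\<in>V. twist d (x i) = (- 1) ^ e i * x i) \<and> parity_grading e V B)"
  using s
proof (induction rule: seed.induct)
  case initial
  then show ?case using skew d twist_var by blast
next
  case (mutation B x k)
  then obtain e where e: "\<forall>i\<in>V. twist d (x i) = (- 1) ^ e i * x i" "parity_grading e V B"
    and skewB: "skew_by D V B" by blast
  define m where "m = (\<Sum>i\<in>V. e i * nat (B i k))"
  define m' where "m' = (\<Sum>i\<in>V. e i * nat (- B i k))"
  have "int m = (\<Sum>i\<in>V. int (e i) * max 0 (B i k))" "int m' = (\<Sum>i\<in>V. int (e i) * max 0 (- B i k))"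
    unfolding m_def m'_def by (auto intro!: sum.cong simp: max_def)
  then have "even m \<longleftrightarrow> even m'"
    using parity_grading_monomials[OF e(2) mutation(2)] by (metis even_of_nat)
  then have mm': "(- 1 :: ratfun) ^ m' = (- 1) ^ m"
    by (simp add: uminus_power_if)
  have "twist d (mutate_cluster V k B x k)
      = (- 1) ^ m * ((\<Prod>i\<in>V. x i ^ nat (B i k)) + (\<Prod>i\<in>V. x i ^ nat (- B i k))) / ((- 1) ^ e k * x k)"
    unfolding mutate_cluster_at[OF fin] twist_divide twist_add twist_monomial[OF e(1)]
      m_def[symmetric] m'_def[symmetric] mm'
    using e(1) mutation(2) by (simp add: distrib_left)
  also have "\<dots> = (- 1) ^ (e k + m) * mutate_cluster V k B x k"
    unfolding mutate_cluster_at[OF fin]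
    by (cases "even (e k)") (simp_all add: power_add)
  finally have "\<forall>i\<in>V. twist d (mutate_cluster V k B x i) = (- 1) ^ (e(k := e k + m)) i * mutate_cluster V k B x i"
    using e(1) by simp
  moreover have "parity_grading (e(k := e k + m)) V (mutate_matrix k B)"
    unfolding m_def by (rule mutate_parity_grading[OF fin skewB e(2) mutation(2)])
  moreover have "skew_by D V (mutate_matrix k B)"
    by (rule mutate_matrix_skew[OF skewB mutation(2)])
  ultimately show ?case by blast
qed

definition flip_frieze :: "nat set \<Rightarrow> exchange_matrix \<Rightarrow> (nat \<Rightarrow> nat) \<Rightarrow> (ratfun \<Rightarrow> int) \<Rightarrow> ratfun \<Rightarrow> int" where
  "flip_frieze V B d f = restrict (\<lambda>x. f (twist d x)) (cluster_algebra V B)"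

context
  fixes V :: "nat set" and B :: exchange_matrix and D :: "nat \<Rightarrow> int" and d :: "nat \<Rightarrow> nat"
  assumes fin: "finite V" and skew: "skew_by D V B" and grad: "parity_grading d V B"
begin

lemma twist_cluster_variable:
  assumes "x \<in> cluster_variables V B"
  shows "twist d x = x \<or> twist d x = - x"
proof -
  obtain B' y i where "seed V B B' y" "i \<in> V" "x = y i"
    using assms unfolding cluster_variables_def by blast
  with twist_seed[OF fin skew grad] obtain n :: nat where "twist d x = (- 1) ^ n * x" by blast
  then show ?thesis by (simp add: uminus_power_if split: if_splits)
qed

lemma twist_cluster_algebra:
  assumes "x \<in> cluster_algebra V B"
  shows "twist d x \<in> cluster_algebra V B"
proof -
  let ?R = "cluster_algebra V B"
  note sub = is_subring_cluster_algebra[of V B]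
  have "cluster_variables V B \<subseteq> {y. twist d y \<in> ?R}"
    using twist_cluster_variable cluster_variables_subset subring_minus[OF sub] by fastforce
  moreover have "is_subring {y. twist d y \<in> ?R}"
    using sub by (simp add: is_subring_def twist_diff twist_mult)
  ultimately have "?R \<subseteq> {y. twist d y \<in> ?R}"
    unfolding cluster_algebra_def by (rule hull_minimal)
  then show ?thesis using assms by blast
qed

lemma flip_frieze_nonzero:
  assumes f: "f \<in> nonzero_friezes V B"
  shows "flip_frieze V B d f \<in> nonzero_friezes V B"
proof -
  let ?R = "cluster_algebra V B"
  note hom = nonzero_frieze_hom[OF f] and sub = is_subring_cluster_algebra[of V B]
  have "flip_frieze V B d f \<in> ring_homs ?R"
    unfolding ring_homs_def flip_frieze_def
    using twist_cluster_algebra sub hom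
    by (simp add: subring_1 subring_add subring_mult twist_add twist_mult hom_1 hom_add hom_mult)
  moreover have "flip_frieze V B d f x \<noteq> 0" if x: "x \<in> cluster_variables V B" for x
  proof -
    have xR: "x \<in> ?R" using x cluster_variables_subset by blast
    have "f x \<noteq> 0" using f x by (simp add: nonzero_friezes_def)
    then show ?thesis
      using twist_cluster_variable[OF x] xR hom_minus[OF hom sub xR] by (auto simp: flip_frieze_def)
  qed
  ultimately show ?thesis by (simp add: nonzero_friezes_def)
qed

lemma flip_frieze_flip:
  assumes f: "f \<in> nonzero_friezes V B"
  shows "flip_frieze V B d (flip_frieze V B d f) = f"
proof
  fix x
  have "f \<in> extensional (cluster_algebra V B)"
    using nonzero_frieze_hom[OF f] by (simp add: ring_homs_def)
  then show "flip_frieze V B d (flip_frieze V B d f) x = f x"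
    using twist_cluster_algebra by (auto simp: flip_frieze_def extensional_def)
qed

lemma flip_frieze_var:
  assumes f: "f \<in> nonzero_friezes V B" and i: "i \<in> V"
  shows "flip_frieze V B d f (var i) = (- 1) ^ d i * f (var i)"
proof -
  note hom = nonzero_frieze_hom[OF f] and sub = is_subring_cluster_algebra[of V B]
  have "var i \<in> cluster_algebra V B"
    using seed_cluster_variable[OF seed.initial i] cluster_variables_subset by blast
  then show ?thesis
    using hom_minus[OF hom sub] by (cases "even (d i)") (auto simp: flip_frieze_def twist_var)
qed

text \<open>The flip of a positive frieze is negative at an initial variable of odd degree, so positive friezes and
their flips are disjoint. By the assumption on signs they exhaust the non-zero friezes.\<close>

theorem friezes_double:
  assumes odd: "\<exists>i\<in>V. odd (d i)"
    and signs: "\<And>f. f \<in> nonzero_friezes V B \<Longrightarrow>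
      (\<forall>i\<in>V. 0 < f (var i)) \<or> (\<forall>i\<in>V. 0 < (- 1) ^ d i * f (var i))"
  shows "nonzero_friezes V B \<approx> (UNIV :: bool set) \<times> positive_friezes V B"
proof -
  let ?N = "nonzero_friezes V B" and ?P = "positive_friezes V B" and ?T = "flip_frieze V B d"
  have PN: "?P \<subseteq> ?N" by (auto simp: nonzero_friezes_def positive_friezes_def)
  have var_pos: "0 < f (var i)" if "f \<in> ?P" "i \<in> V" for f i
    using that seed_cluster_variable[OF seed.initial] by (simp add: positive_friezes_def)
  obtain i where i: "i \<in> V" "odd (d i)" using odd by blast
  have disj: "?T f \<notin> ?P" if "f \<in> ?P" for f
  proof
    assume "?T f \<in> ?P"
    then have "0 < (- 1) ^ d i * f (var i)"
      using var_pos i(1) flip_frieze_var[of f i] that PN by fastforce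
    then show False using var_pos[OF that i(1)] i(2) by simp
  qed
  have "bij_betw (\<lambda>(b, f). if b then f else ?T f) (UNIV \<times> ?P) ?N"
    unfolding bij_betw_def
  proof
    show "inj_on (\<lambda>(b, f). if b then f else ?T f) (UNIV \<times> ?P)"
    proof (rule inj_onI, clarsimp)
      fix b f b' f'
      assume "f \<in> ?P" "f' \<in> ?P" and eq: "(if b then f else ?T f) = (if b' then f' else ?T f')"
      then show "b = b' \<and> f = f'"
        using disj flip_frieze_flip PN by (metis subsetD)
    qed
    show "(\<lambda>(b, f). if b then f else ?T f) ` (UNIV \<times> ?P) = ?N"
    proof
      show "(\<lambda>(b, f). if b then f else ?T f) ` (UNIV \<times> ?P) \<subseteq> ?N"
        using PN flip_frieze_nonzero by auto
      show "?N \<subseteq> (\<lambda>(b, f). if b then f else ?T f) ` (UNIV \<times> ?P)"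
      proof
        fix f assume f: "f \<in> ?N"
        from signs[OF f] show "f \<in> (\<lambda>(b, f). if b then f else ?T f) ` (UNIV \<times> ?P)"
        proof
          assume "\<forall>i\<in>V. 0 < f (var i)"
          then have "f \<in> ?P" by (rule positive_of_initial[OF fin f])
          then show ?thesis by (intro image_eqI[of _ _ "(True, f)"]) auto
        next
          assume "\<forall>i\<in>V. 0 < (- 1) ^ d i * f (var i)"
          then have "?T f \<in> ?P"
            using flip_frieze_var[OF f] by (intro positive_of_initial[OF fin flip_frieze_nonzero[OF f]]) simp
          then show ?thesis using flip_frieze_flip[OF f]
            by (intro image_eqI[of _ _ "(False, ?T f)"]) auto
        qed
      qed
    qed
  qed
  then show ?thesis using eqpoll_def eqpoll_sym by blast
qed

end

section \<open>Slices of a chain\<close>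

text \<open>The absolute values of the exchange matrix. The chain is simply laced except at its end, where the
entries \<open>(k - 1, k)\<close> and \<open>(k, k - 1)\<close> are \<open>p\<close> and \<open>q\<close>: these
are 1 and 2 in type B, and 2 and 1 in type C.\<close>

definition weight :: "nat \<Rightarrow> nat \<Rightarrow> nat \<Rightarrow> nat \<Rightarrow> nat \<Rightarrow> nat" where
  "weight k p q i j = (if i + 1 = j \<or> i = j + 1
     then if j = k then p else if i = k then q else 1 else 0)"

text \<open>The orientation of the edge between \<open>i\<close> and \<open>i + 1\<close> is the sign \<open>s
i\<close>. As the entries between vertices of the chain depend on the values of \<open>s\<close> on
\<open>{1..<k}\<close> alone, signs can be changed at both sides of any vertex without a special case at the ends
of the chain.\<close>

definition chain_matrix :: "nat \<Rightarrow> nat \<Rightarrow> nat \<Rightarrow> (nat \<Rightarrow> int) \<Rightarrow> exchange_matrix" where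
  "chain_matrix k p q s i j = (if i < j then s i else - s j) * int (weight k p q i j)"

definition left_factor :: "nat \<Rightarrow> nat \<Rightarrow> nat \<Rightarrow> (nat \<Rightarrow> int) \<Rightarrow> nat \<Rightarrow> int" where
  "left_factor k p q g j = (if j = 1 then 1 else g (j - 1) ^ weight k p q (j - 1) j)"

definition right_factor :: "nat \<Rightarrow> nat \<Rightarrow> nat \<Rightarrow> (nat \<Rightarrow> int) \<Rightarrow> nat \<Rightarrow> int" where
  "right_factor k p q g j = (if j = k then 1 else g (j + 1) ^ weight k p q (j + 1) j)"

lemma neighbours:
  assumes "j \<in> {1..k}" "i \<in> {1..k}" "weight k p q i j \<noteq> 0"
  shows "j \<noteq> 1 \<and> i = j - 1 \<or> j \<noteq> k \<and> i = j + 1"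
  using assms by (auto simp: weight_def split: if_splits)

lemma prod_neighbours:
  assumes j: "j \<in> {1..k}"
  shows "(\<Prod>i\<in>{1..k}. g i ^ weight k p q i j) = left_factor k p q g j * right_factor k p q g j"
proof -
  let ?h = "\<lambda>i. g i ^ weight k p q i j"
  let ?N = "(if j = 1 then {} else {j - 1}) \<union> (if j = k then {} else {j + 1})"
  have "(\<Prod>i\<in>{1..k}. ?h i) = (\<Prod>i\<in>?N. ?h i)"
  proof (rule prod.mono_neutral_right)
    show "\<forall>i\<in>{1..k} - ?N. ?h i = 1"
    proof
      fix i assume "i \<in> {1..k} - ?N"
      then have "weight k p q i j = 0" using neighbours[OF j, of i p q] by (auto split: if_splits)
      then show "?h i = 1" by simp
    qed
  qed (use j in auto)
  also have "\<dots> = left_factor k p q g j * right_factor k p q g j"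
    using j by (auto simp: left_factor_def right_factor_def)
  finally show ?thesis .
qed

lemma sum_neighbours:
  assumes j: "j \<in> {1..k}"
  shows "(\<Sum>i\<in>{1..k}. h i * weight k p q i j)
    = (if j = 1 then 0 else h (j - 1) * weight k p q (j - 1) j)
      + (if j = k then 0 else h (j + 1) * weight k p q (j + 1) j)"
proof -
  let ?N = "(if j = 1 then {} else {j - 1}) \<union> (if j = k then {} else {j + 1})"
  have "(\<Sum>i\<in>{1..k}. h i * weight k p q i j) = (\<Sum>i\<in>?N. h i * weight k p q i j)"
  proof (rule sum.mono_neutral_right)
    show "\<forall>i\<in>{1..k} - ?N. h i * weight k p q i j = 0"
    proof
      fix i assume "i \<in> {1..k} - ?N"
      then have "weight k p q i j = 0" using neighbours[OF j, of i p q] by (auto split: if_splits)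
      then show "h i * weight k p q i j = 0" by simp
    qed
  qed (use j in auto)
  also have "\<dots> = (if j = 1 then 0 else h (j - 1) * weight k p q (j - 1) j)
      + (if j = k then 0 else h (j + 1) * weight k p q (j + 1) j)"
    using j by auto
  finally show ?thesis .
qed

text \<open>The parity condition for the weights without signs; it serves all orientations of the chain at
once.\<close>

definition chain_parity :: "nat \<Rightarrow> nat \<Rightarrow> nat \<Rightarrow> (nat \<Rightarrow> nat) \<Rightarrow> bool" where
  "chain_parity k p q d \<longleftrightarrow> (\<forall>j\<in>{1..k}. even (\<Sum>i\<in>{1..k}. d i * weight k p q i j))"

context
  fixes k p q :: nat and B0 :: exchange_matrix and s0 :: "nat \<Rightarrow> int"
  assumes pos_k: "2 \<le> k" and pos_pq: "0 < p" "0 < q"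
    and B0: "\<And>i j. i \<in> {1..k} \<Longrightarrow> j \<in> {1..k} \<Longrightarrow> B0 i j = chain_matrix k p q s0 i j"
    and s0: "\<And>i. s0 i \<in> {1, - 1}"
begin

lemma chain_skew: "skew_by (\<lambda>i. if i = k then int p else int q) {1..k} B0"
  unfolding skew_by_def
proof (intro conjI ballI)
  fix i j assume ij: "i \<in> {1..k}" "j \<in> {1..k}"
  show "(if i = k then int p else int q) * B0 i j = - ((if j = k then int p else int q) * B0 j i)"
    unfolding B0[OF ij] B0[OF ij(2,1)] using ij
    by (auto simp: chain_matrix_def weight_def)
qed (use pos_pq in auto)

lemma chain_parity_grading:
  assumes "chain_parity k p q d"
  shows "parity_grading d {1..k} B0"
  unfolding parity_grading_def
proof
  fix j assume j: "j \<in> {1..k}"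
  have "even (int (d i) * B0 i j - int (d i * weight k p q i j))" if i: "i \<in> {1..k}" for i
    unfolding B0[OF i j] using s0[of i] s0[of j] by (auto simp: chain_matrix_def)
  then have "even (\<Sum>i\<in>{1..k}. int (d i) * B0 i j - int (d i * weight k p q i j))"
    by (rule dvd_sum)
  moreover have "even (int (\<Sum>i\<in>{1..k}. d i * weight k p q i j))"
    using assms j unfolding chain_parity_def even_of_nat by blast
  ultimately show "even (\<Sum>i\<in>{1..k}. int (d i) * B0 i j)"
    unfolding sum_subtractf of_nat_sum by simp
qed

context
  fixes f :: "ratfun \<Rightarrow> int"
  assumes f: "f \<in> nonzero_friezes {1..k} B0"
begin

text \<open>A cluster on the chain with orientation \<open>s\<close>. The second part records that signs found at
this cluster hold at the initial cluster as well, if they come from a parity grading.\<close>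

definition slice :: "(nat \<Rightarrow> int) \<Rightarrow> (nat \<Rightarrow> ratfun) \<Rightarrow> bool" where
  "slice s x \<longleftrightarrow>
     (\<exists>B. seed {1..k} B0 B x \<and> (\<forall>i\<in>{1..k}. \<forall>j\<in>{1..k}. B i j = chain_matrix k p q s i j)) \<and>
     (\<forall>d. chain_parity k p q d \<longrightarrow> (\<forall>i\<in>{1..k}. 0 < (- 1) ^ d i * f (x i)) \<longrightarrow>
        (\<forall>i\<in>{1..k}. 0 < (- 1) ^ d i * f (var i)))"

lemma slice_initial: "slice s0 var"
  unfolding slice_def using B0 seed.initial by blast

lemma slice_nonzero: "slice s x \<Longrightarrow> i \<in> {1..k} \<Longrightarrow> f (x i) \<noteq> 0"
  unfolding slice_def using nonzero_frieze_seed[OF f] by blast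

lemma slice_signs:
  assumes "slice s x" "chain_parity k p q d" "\<forall>i\<in>{1..k}. 0 < (- 1) ^ d i * f (x i)"
  shows "\<forall>i\<in>{1..k}. 0 < (- 1) ^ d i * f (var i)"
  using assms unfolding slice_def by blast

lemma slice_cong:
  assumes "slice s x" "\<And>i. 1 \<le> i \<Longrightarrow> i < k \<Longrightarrow> s i = t i"
  shows "slice t x"
proof -
  have "chain_matrix k p q s i j = chain_matrix k p q t i j" if "i \<in> {1..k}" "j \<in> {1..k}" for i j
    using that assms(2)[of i] assms(2)[of j] by (auto simp: chain_matrix_def weight_def)
  then show ?thesis using assms(1) unfolding slice_def by force
qed

text \<open>At a source or a sink one exchange monomial is 1, and mutation reverses the edges at \<open>j\<close>
without other changes, since no path of length two passes through \<open>j\<close>. The other monomial has even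
degree, so its value is positive for the signs under consideration and the old and new values at \<open>j\<close>
have the same sign.\<close>

lemma slice_mutation:
  assumes sl: "slice s x" and s: "\<And>i. s i \<in> {1, - 1}" and j: "j \<in> {1..k}"
    and extremal: "j = 1 \<or> j = k \<or> s (j - 1) \<noteq> s j"
  shows "\<exists>y. slice (s(j - 1 := - s (j - 1), j := - s j)) y \<and> (\<forall>i. i \<noteq> j \<longrightarrow> y i = x i)
    \<and> f (x j) * f (y j) = 1 + left_factor k p q (f \<circ> x) j * right_factor k p q (f \<circ> x) j"
proof -
  let ?V = "{1..k}" and ?t = "s(j - 1 := - s (j - 1), j := - s j)"
  let ?W = "\<lambda>i. weight k p q i j"
  obtain B where seed: "seed ?V B0 B x"
    and B: "\<And>i l. i \<in> ?V \<Longrightarrow> l \<in> ?V \<Longrightarrow> B i l = chain_matrix k p q s i l"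
    using sl unfolding slice_def by blast
  let ?y = "mutate_cluster ?V j B x"
  \<comment> \<open>The common sign of the entries in column \<open>j\<close>.\<close>
  define \<epsilon> where "\<epsilon> = (if j = 1 then - s j else s (j - 1))"
  have e: "\<epsilon> \<in> {1, - 1}" using s[of j] s[of "j - 1"] by (auto simp: \<epsilon>_def)
  have sm: "s (j - 1) = - s j" if "j \<noteq> 1" "j \<noteq> k"
    using extremal s[of "j - 1"] s[of j] that by auto
  have col: "B i j = \<epsilon> * int (?W i)" if "i \<in> ?V" for i
  proof (cases "?W i = 0")
    case True
    then show ?thesis using B[OF that j] by (simp add: chain_matrix_def)
  next
    case False
    then show ?thesis using B[OF that j] neighbours[OF j that False] sm j
      by (auto simp: chain_matrix_def \<epsilon>_def)
  qed
  have row: "B j l = - \<epsilon> * int (weight k p q j l)" if "l \<in> ?V" for l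
  proof (cases "weight k p q j l = 0")
    case True
    then show ?thesis using B[OF j that] by (simp add: chain_matrix_def)
  next
    case False
    then have "?W l \<noteq> 0" using pos_pq by (auto simp: weight_def split: if_splits)
    then show ?thesis using B[OF j that] neighbours[OF j that, of p q] sm j
      by (auto simp: chain_matrix_def \<epsilon>_def)
  qed
  have mut: "mutate_matrix j B i l = chain_matrix k p q ?t i l" if il: "i \<in> ?V" "l \<in> ?V" for i l
  proof (cases "i = j \<or> l = j")
    case True
    then have "mutate_matrix j B i l = - chain_matrix k p q s i l"
      using B[OF il] by (auto simp: mutate_matrix_def)
    also have "\<dots> = chain_matrix k p q ?t i l"
      using True il by (auto simp: chain_matrix_def weight_def)
    finally show ?thesis .
  next
    case False
    have "B i j * B j l = - (int (?W i) * int (weight k p q j l))"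
      unfolding col[OF il(1)] row[OF il(2)] using e by auto
    then have "mutate_matrix j B i l = B i l"
      using False by (simp add: mutate_matrix_def)
    also have "\<dots> = chain_matrix k p q ?t i l"
      unfolding B[OF il] using False il by (auto simp: chain_matrix_def weight_def)
    finally show ?thesis .
  qed
  have pow: "(\<Prod>i\<in>?V. f (x i) ^ nat (\<epsilon> * int (?W i))) + (\<Prod>i\<in>?V. f (x i) ^ nat (- (\<epsilon> * int (?W i))))
      = 1 + (\<Prod>i\<in>?V. f (x i) ^ ?W i)"
    using e by auto
  have exch: "f (x j) * f (?y j) = 1 + (\<Prod>i\<in>?V. f (x i) ^ ?W i)"
    unfolding exchange_value[OF finite_atLeastAtMost f seed j] pow[symmetric]
    by (intro arg_cong2[of _ _ _ _ "(+)"] prod.cong refl) (simp_all add: col)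
  have signs: "\<forall>i\<in>?V. 0 < (- 1) ^ d i * f (var i)"
    if d: "chain_parity k p q d" and pos: "\<forall>i\<in>?V. 0 < (- 1) ^ d i * f (?y i)" for d
  proof -
    have "\<forall>i\<in>?V. 0 < (- 1) ^ d i * f (x i)"
    proof
      fix i assume i: "i \<in> ?V"
      show "0 < (- 1) ^ d i * f (x i)"
      proof (cases "i = j")
        case False
        then show ?thesis using pos i by (metis mutate_cluster_other)
      next
        case True
        \<comment> \<open>Each factor may be replaced by its absolute value, as the monomial has even degree.\<close>
        have "0 < (\<Prod>i\<in>?V. ((- 1) ^ d i * f (x i)) ^ ?W i)"
        proof (rule prod_pos)
          fix i assume i: "i \<in> ?V"
          show "0 < ((- 1) ^ d i * f (x i)) ^ ?W i"
          proof (cases "i = j")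
            case True
            then show ?thesis by (simp add: weight_def)
          next
            case False
            then show ?thesis using pos i by (metis mutate_cluster_other zero_less_power)
          qed
        qed
        also have "\<dots> = (- 1) ^ (\<Sum>i\<in>?V. d i * ?W i) * (\<Prod>i\<in>?V. f (x i) ^ ?W i)"
          by (simp add: power_mult_distrib prod.distrib power_sum power_mult)
        also have "\<dots> = (\<Prod>i\<in>?V. f (x i) ^ ?W i)"
          using d j unfolding chain_parity_def by simp
        finally have "0 < f (x j) * f (?y j)" unfolding exch by simp
        moreover have "0 < (- 1) ^ d j * f (?y j)" using pos j by blast
        ultimately show ?thesis
          unfolding True by (cases "even (d j)") (auto simp: zero_less_mult_iff)
      qed
    qed
    then show ?thesis using sl d unfolding slice_def by blast
  qed
  have "slice ?t ?y"
    unfolding slice_def using mutation[OF seed j] mut signs by blast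
  moreover have "(\<Prod>i\<in>?V. f (x i) ^ ?W i) = left_factor k p q (f \<circ> x) j * right_factor k p q (f \<circ> x) j"
    using prod_neighbours[OF j, of "f \<circ> x"] by simp
  ultimately show ?thesis
    using exch mutate_cluster_other[of _ j ?V B x] by (intro exI[of _ ?y]) simp
qed

text \<open>Induction on the number of edges at the start of the chain that may change. To reverse the last of
them, the one from \<open>m\<close> to \<open>m + 1\<close>, the edge before it is first oriented such that
\<open>m\<close> is a source or a sink; mutation at \<open>m\<close> reverses both, and then the edges before
\<open>m\<close> are put right.\<close>

lemma slice_reorient:
  assumes "slice s x" "\<And>i. s i \<in> {1, - 1}" "\<And>i. t i \<in> {1, - 1}"
    and "\<And>i. m \<le> i \<Longrightarrow> i < k \<Longrightarrow> t i = s i"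
  shows "\<exists>y. slice t y"
  using assms
proof (induction m arbitrary: s t x)
  case 0
  then show ?case using slice_cong by (metis zero_le)
next
  case (Suc m)
  show ?case
  proof (cases "m = 0 \<or> k \<le> m \<or> t m = s m")
    case True
    then consider "m = 0" | "m \<noteq> 0" "\<And>i. m \<le> i \<Longrightarrow> i < k \<Longrightarrow> t i = s i"
      using Suc.prems(4) by (metis le_trans not_less le_neq_implies_less Suc_leI)
    then show ?thesis
    proof cases
      case 1
      then show ?thesis using Suc.prems(1,4) slice_cong[of s x t] by auto
    next
      case 2
      from 2(2) show ?thesis by (rule Suc.IH[OF Suc.prems(1,2,3)])
    qed
  next
    case False
    then have m: "m \<in> {1..k}" "0 < m" "m < k" and tm: "t m = - s m"
      using Suc.prems(2)[of m] Suc.prems(3)[of m] by auto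
    define u where "u = s(m - 1 := - s m)"
    have u: "u i \<in> {1, - 1}" for i using Suc.prems(2)[of i] Suc.prems(2)[of m] by (auto simp: u_def)
    have "u i = s i" if "m \<le> i" for i using that m by (auto simp: u_def)
    then obtain y where y: "slice u y"
      using Suc.IH[OF Suc.prems(1,2), of u] u by blast
    have "u (m - 1) \<noteq> u m" using Suc.prems(2)[of m] m by (auto simp: u_def)
    then obtain z where z: "slice (u(m - 1 := - u (m - 1), m := - u m)) z"
      using slice_mutation[OF y u m(1)] by blast
    show ?thesis
    proof (rule Suc.IH[OF z])
      show "(u(m - 1 := - u (m - 1), m := - u m)) i \<in> {1, - 1}" for i
        using u[of i] u[of "m - 1"] u[of m] by auto
      show "t i \<in> {1, - 1}" for i by (rule Suc.prems(3))
      show "t i = (u(m - 1 := - u (m - 1), m := - u m)) i" if "m \<le> i" "i < k" for i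
        using that tm m Suc.prems(4)[of i] by (cases "i = m") (auto simp: u_def)
    qed
  qed
qed

text \<open>After the mutations at \<open>1, \<dots>, n\<close> the only edge with the opposite orientation is the
one from \<open>n\<close> to \<open>n + 1\<close>, so \<open>n + 1\<close> is a source or a sink. When it is
mutated, its left neighbour is new and its right neighbour is old.\<close>

lemma slice_pass:
  assumes x: "slice (\<lambda>_. 1) x"
  shows "\<exists>y. slice (\<lambda>_. 1) y \<and>
    (\<forall>j\<in>{1..k}. f (x j) * f (y j) = 1 + left_factor k p q (f \<circ> y) j * right_factor k p q (f \<circ> x) j)"
proof -
  have "\<exists>y. slice (\<lambda>i. if i = n then - 1 else 1) y \<and> (\<forall>i>n. y i = x i) \<and>
    (\<forall>j\<in>{1..n}. f (x j) * f (y j) = 1 + left_factor k p q (f \<circ> y) j * right_factor k p q (f \<circ> x) j)"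
    if "n \<le> k" for n
    using that
  proof (induction n)
    case 0
    have "slice (\<lambda>i. if i = 0 then - 1 else 1) x"
      by (rule slice_cong[OF x]) simp
    then show ?case by (intro exI[of _ x]) simp
  next
    case (Suc n)
    obtain y where y: "slice (\<lambda>i. if i = n then - 1 else 1) y" "\<forall>i>n. y i = x i"
      "\<forall>j\<in>{1..n}. f (x j) * f (y j) = 1 + left_factor k p q (f \<circ> y) j * right_factor k p q (f \<circ> x) j"
      using Suc.IH[OF Suc_leD[OF Suc.prems]] by blast
    let ?s = "\<lambda>i. if i = n then - 1 else 1 :: int"
    obtain z where z: "slice (?s(Suc n - 1 := - ?s (Suc n - 1), Suc n := - ?s (Suc n))) z"
      "\<forall>i. i \<noteq> Suc n \<longrightarrow> z i = y i"
      "f (y (Suc n)) * f (z (Suc n)) = 1 + left_factor k p q (f \<circ> y) (Suc n) * right_factor k p q (f \<circ> y) (Suc n)"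
    proof -
      have "?s i \<in> {1, - 1}" for i by simp
      moreover have "Suc n \<in> {1..k}" using Suc.prems by simp
      moreover have "?s (Suc n - 1) \<noteq> ?s (Suc n)" by simp
      ultimately show ?thesis using slice_mutation[OF y(1), of "Suc n"] that by blast
    qed
    have "?s(Suc n - 1 := - ?s (Suc n - 1), Suc n := - ?s (Suc n)) = (\<lambda>i. if i = Suc n then - 1 else 1)"
      by auto
    then have 1: "slice (\<lambda>i. if i = Suc n then - 1 else 1) z" using z(1) by simp
    have 2: "\<forall>i>Suc n. z i = x i" using y(2) z(2) by simp
    have left: "left_factor k p q (f \<circ> z) j = left_factor k p q (f \<circ> y) j" if "j \<in> {1..Suc n}" for j
      using that z(2) by (auto simp: left_factor_def)
    have right: "right_factor k p q (f \<circ> y) (Suc n) = right_factor k p q (f \<circ> x) (Suc n)"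
      using y(2) by (simp add: right_factor_def)
    have "f (x j) * f (z j) = 1 + left_factor k p q (f \<circ> z) j * right_factor k p q (f \<circ> x) j"
      if j: "j \<in> {1..Suc n}" for j
    proof (cases "j = Suc n")
      case True
      then show ?thesis using z(3) left[OF j] right y(2) by simp
    next
      case False
      then show ?thesis using y(3) z(2) left[OF j] j by auto
    qed
    then show ?case using 1 2 by blast
  qed
  from this[of k] obtain y where y: "slice (\<lambda>i. if i = k then - 1 else 1) y"
    "\<forall>j\<in>{1..k}. f (x j) * f (y j) = 1 + left_factor k p q (f \<circ> y) j * right_factor k p q (f \<circ> x) j"
    by blast
  moreover have "slice (\<lambda>_. 1) y" by (rule slice_cong[OF y(1)]) simp
  ultimately show ?thesis by blast
qed

lemma slice_sequence:
  "\<exists>X. \<forall>t. slice (\<lambda>_. 1) (X t) \<and> (\<forall>j\<in>{1..k}. f (X t j) * f (X (Suc t) j)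
     = 1 + left_factor k p q (f \<circ> X (Suc t)) j * right_factor k p q (f \<circ> X t) j)"
proof -
  have "\<exists>x. slice (\<lambda>_. 1) x"
    using slice_reorient[OF slice_initial s0, of "\<lambda>_. 1" k] by auto
  then obtain X where "\<forall>t. slice (\<lambda>_. 1) (X t)"
    "\<forall>t. \<forall>j\<in>{1..k}. f (X t j) * f (X (Suc t) j)
     = 1 + left_factor k p q (f \<circ> X (Suc t)) j * right_factor k p q (f \<circ> X t) j"
    using slice_pass dependent_nat_choice[of "\<lambda>_ x. slice (\<lambda>_. 1) x"
      "\<lambda>_ x y. \<forall>j\<in>{1..k}. f (x j) * f (y j) = 1 + left_factor k p q (f \<circ> y) j * right_factor k p q (f \<circ> x) j"]
    by metis
  then show ?thesis by blast
qed

end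

end

section \<open>Chains of types B and C\<close>

lemma chain_parity_C: "chain_parity k 2 1 (\<lambda>i. i)"
  unfolding chain_parity_def
proof
  fix j assume j: "j \<in> {1..k}"
  show "even (\<Sum>i\<in>{1..k}. i * weight k 2 1 i j)"
    unfolding sum_neighbours[OF j, of "\<lambda>i. i"] using j
    by (auto simp: weight_def)
qed

lemma chain_parity_B: "chain_parity k 1 2 (\<lambda>i. if i = k then 1 else 0)"
  unfolding chain_parity_def
proof
  fix j assume j: "j \<in> {1..k}"
  show "even (\<Sum>i\<in>{1..k}. (if i = k then 1 else 0) * weight k 1 2 i j)"
    unfolding sum_neighbours[OF j, of "\<lambda>i. if i = k then 1 else 0"] using j
    by (auto simp: weight_def)
qed

lemma chain_parity_0: "chain_parity k p q (\<lambda>_. 0)"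
  by (simp add: chain_parity_def)

context
  fixes k :: nat and B :: exchange_matrix and s :: "nat \<Rightarrow> int" and f :: "ratfun \<Rightarrow> int"
  assumes k: "2 \<le> k" and s: "\<And>i. s i \<in> {1, - 1}" and f: "f \<in> nonzero_friezes {1..k} B"
begin

text \<open>The mutation at \<open>k\<close> reads \<open>a k t * a k (t + 1) = 1 + (a (k - 1) (t +
1))\<^sup>2\<close>, which is the case of trace 0.\<close>

lemma signs_C:
  assumes B: "\<And>i j. i \<in> {1..k} \<Longrightarrow> j \<in> {1..k} \<Longrightarrow> B i j = chain_matrix k 2 1 s i j"
  shows "(\<forall>i\<in>{1..k}. 0 < f (var i)) \<or> (\<forall>i\<in>{1..k}. 0 < (- 1) ^ i * f (var i))"
proof -
  note ctx = k zero_less_numeral zero_less_one B s f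
  let ?slice = "slice k 2 1 B f"
  obtain X where X: "\<And>t. ?slice (\<lambda>_. 1) (X t)"
    and rel: "\<And>t j. j \<in> {1..k} \<Longrightarrow> f (X t j) * f (X (Suc t) j)
      = 1 + left_factor k 2 1 (f \<circ> X (Suc t)) j * right_factor k 2 1 (f \<circ> X t) j"
    using slice_sequence[OF ctx] by blast
  define a where "a i t = (if i = 0 then 1 else f (X t i))" for i t
  have "\<exists>\<epsilon>\<in>{1, - 1}. (\<forall>i\<le>k. \<forall>t. 0 < \<epsilon> ^ i * a i t) \<and> - 2 < \<epsilon> ^ (k + 1) * 0"
  proof (rule frieze_pattern_signs)
    show "a i t \<noteq> 0" if "1 \<le> i" "i \<le> k" for i t
      using slice_nonzero[OF ctx X, of i t] that by (simp add: a_def)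
    show "a i t * a i (Suc t) = 1 + a (i - 1) (Suc t) * a (i + 1) t" if "1 \<le> i" "i < k" for i t
      using rel[of i t] that by (auto simp: a_def left_factor_def right_factor_def weight_def)
    show "a k t * a k (Suc t) = 1 + a (k - 1) (Suc t) * (a (k - 1) (Suc t) + 0)" for t
      using rel[of k t] k by (auto simp: a_def left_factor_def right_factor_def weight_def power2_eq_square)
  qed (use k in \<open>auto simp: a_def\<close>)
  then obtain \<epsilon> :: int where e: "\<epsilon> \<in> {1, - 1}" and pos: "\<And>i. i \<le> k \<Longrightarrow> 0 < \<epsilon> ^ i * a i 0"
    by blast
  have transfer: "\<forall>i\<in>{1..k}. 0 < (- 1) ^ d i * f (var i)"
    if "chain_parity k 2 1 d" "\<forall>i\<in>{1..k}. 0 < (- 1) ^ d i * f (X 0 i)" for d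
    by (rule slice_signs[OF ctx X[of 0] that])
  have pos': "0 < \<epsilon> ^ i * f (X 0 i)" if "i \<in> {1..k}" for i
    using pos[of i] that by (simp add: a_def)
  from e consider "\<epsilon> = 1" | "\<epsilon> = - 1" by blast
  then show ?thesis
  proof cases
    case 1
    then have "\<forall>i\<in>{1..k}. 0 < (- 1) ^ 0 * f (X 0 i)" using pos' by force
    from transfer[OF chain_parity_0 this] show ?thesis by simp
  next
    case 2
    then have "\<forall>i\<in>{1..k}. 0 < (- 1) ^ i * f (X 0 i)" using pos' by blast
    from transfer[OF chain_parity_C this] show ?thesis by simp
  qed
qed

text \<open>The mutation at \<open>k - 1\<close> involves the square \<open>y\<^sup>2\<close> of the value
\<open>y\<close> at \<open>k\<close>, so these squares form the last row of the pattern. Squaring the relation at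
\<open>k\<close>, where \<open>a = a (k - 1) (t + 1)\<close>, gives the right hand side \<open>(1 + a)\<^sup>2 = 1
+ a * (a + 2)\<close>, which is the case of trace 2.\<close>

lemma signs_B:
  assumes B: "\<And>i j. i \<in> {1..k} \<Longrightarrow> j \<in> {1..k} \<Longrightarrow> B i j = chain_matrix k 1 2 s i j"
  shows "(\<forall>i\<in>{1..k}. 0 < f (var i))
    \<or> (\<forall>i\<in>{1..k}. 0 < (- 1) ^ (if i = k then 1 else 0 :: nat) * f (var i))"
proof -
  note ctx = k zero_less_one zero_less_numeral B s f
  let ?slice = "slice k 1 2 B f"
  obtain X where X: "\<And>t. ?slice (\<lambda>_. 1) (X t)"
    and rel: "\<And>t j. j \<in> {1..k} \<Longrightarrow> f (X t j) * f (X (Suc t) j)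
      = 1 + left_factor k 1 2 (f \<circ> X (Suc t)) j * right_factor k 1 2 (f \<circ> X t) j"
    using slice_sequence[OF ctx] by blast
  have nz: "f (X t i) \<noteq> 0" if "i \<in> {1..k}" for t i
    using slice_nonzero[OF ctx X that] .
  define a where "a i t = (if i = 0 then 1 else if i = k then (f (X t k))\<^sup>2 else f (X t i))" for i t
  have "\<exists>\<epsilon>\<in>{1, - 1}. (\<forall>i\<le>k. \<forall>t. 0 < \<epsilon> ^ i * a i t) \<and> - 2 < \<epsilon> ^ (k + 1) * 2"
  proof (rule frieze_pattern_signs)
    show "a i t \<noteq> 0" if "1 \<le> i" "i \<le> k" for i t
      using nz[of i t] that by (auto simp: a_def)
    show "a i t * a i (Suc t) = 1 + a (i - 1) (Suc t) * a (i + 1) t" if "1 \<le> i" "i < k" for i t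
      using rel[of i t] that by (auto simp: a_def left_factor_def right_factor_def weight_def)
    show "a k t * a k (Suc t) = 1 + a (k - 1) (Suc t) * (a (k - 1) (Suc t) + 2)" for t
    proof -
      have "k - 1 \<noteq> 0" "k - 1 \<noteq> k" "k \<noteq> 1" "k \<in> {1..k}" using k by auto
      then have "f (X t k) * f (X (Suc t) k) = 1 + a (k - 1) (Suc t)"
        using rel[of k t] by (simp add: a_def left_factor_def right_factor_def weight_def)
      then have "(f (X t k) * f (X (Suc t) k))\<^sup>2 = (1 + a (k - 1) (Suc t))\<^sup>2" by simp
      moreover have "a k t * a k (Suc t) = (f (X t k) * f (X (Suc t) k))\<^sup>2"
        using k by (simp add: a_def power_mult_distrib)
      ultimately show ?thesis by (simp add: power2_eq_square algebra_simps)
    qed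
  qed (use k in \<open>auto simp: a_def\<close>)
  then obtain \<epsilon> :: int where e: "\<epsilon> \<in> {1, - 1}" and pos: "\<And>i. i \<le> k \<Longrightarrow> 0 < \<epsilon> ^ i * a i 0"
    and last: "- 2 < \<epsilon> ^ (k + 1) * 2"
    by blast
  \<comment> \<open>A square is positive, so \<open>\<epsilon> ^ k = 1\<close>; the trace bound then leaves \<open>\<epsilon> = 1\<close>.\<close>
  have "0 \<le> a k 0" using k by (simp add: a_def)
  then have "0 < \<epsilon> ^ k" using pos[of k] by (smt (verit) order_refl mult_nonpos_nonneg)
  then have "\<epsilon> ^ k = 1" using e by (cases "even k") auto
  then have "\<epsilon> = 1" using last e by auto
  then have pos': "0 < f (X 0 i)" if "i \<in> {1..k}" "i \<noteq> k" for i
    using pos[of i] that by (simp add: a_def)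
  have transfer: "\<forall>i\<in>{1..k}. 0 < (- 1) ^ d i * f (var i)"
    if "chain_parity k 1 2 d" "\<forall>i\<in>{1..k}. 0 < (- 1) ^ d i * f (X 0 i)" for d
    by (rule slice_signs[OF ctx X[of 0] that])
  from nz[of k 0] k consider "0 < f (X 0 k)" | "f (X 0 k) < 0" by force
  then show ?thesis
  proof cases
    case 1
    have "0 < f (X 0 i)" if "i \<in> {1..k}" for i
      using 1 pos'[OF that] by (cases "i = k") simp_all
    then have "\<forall>i\<in>{1..k}. 0 < (- 1) ^ 0 * f (X 0 i)" by simp
    from transfer[OF chain_parity_0 this] show ?thesis by simp
  next
    case 2
    then have "\<forall>i\<in>{1..k}. 0 < (- 1) ^ (if i = k then 1 else 0 :: nat) * f (X 0 i)"
      using pos' by auto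
    from transfer[OF chain_parity_B this] show ?thesis by blast
  qed
qed

end

lemma orientation_sign:
  assumes Q: "orientation E Q" and e: "{i, j} \<in> E" and ij: "i \<noteq> j"
  shows "quiver_matrix Q i j \<in> {1, - 1}"
proof -
  have inj: "inj_on (\<lambda>(i, j). {i, j}) Q" and im: "(\<lambda>(i, j). {i, j}) ` Q = E"
    using Q by (auto simp: orientation_def bij_betw_def)
  obtain a b where ab: "(a, b) \<in> Q" "{i, j} = {a, b}" using e im by auto
  then have "(i, j) \<in> Q \<or> (j, i) \<in> Q" by (auto simp: doubleton_eq_iff)
  moreover have "\<not> ((i, j) \<in> Q \<and> (j, i) \<in> Q)"
    using inj ij unfolding inj_on_def by (auto simp: insert_commute)
  ultimately show ?thesis by (auto simp: quiver_matrix_def)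
qed

lemma orientation_nonedge:
  assumes Q: "orientation E Q" and e: "{i, j} \<notin> E"
  shows "quiver_matrix Q i j = 0"
proof -
  have im: "(\<lambda>(i, j). {i, j}) ` Q = E"
    using Q by (auto simp: orientation_def bij_betw_def)
  have "{a, b} \<in> E" if "(a, b) \<in> Q" for a b
    unfolding im[symmetric] by (rule image_eqI[OF _ that]) simp
  then have "(i, j) \<notin> Q" "(j, i) \<notin> Q" using e by (metis insert_commute)+
  then show ?thesis by (simp add: quiver_matrix_def)
qed

lemma quiver_matrix_skew: "quiver_matrix Q j i = - quiver_matrix Q i j"
  by (simp add: quiver_matrix_def)

lemma quiver_automorphism_matrix:
  assumes "quiver_automorphism V Q g" "i \<in> V" "j \<in> V"
  shows "quiver_matrix Q (g i) (g j) = quiver_matrix Q i j"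
  using assms by (simp add: quiver_automorphism_def quiver_matrix_def)

lemma edges_A_iff: "{i, j} \<in> edges_A n \<longleftrightarrow> 1 \<le> i \<and> i < n \<and> j = i + 1 \<or> 1 \<le> j \<and> j < n \<and> i = j + 1"
  unfolding edges_A_def by (auto simp: doubleton_eq_iff)

lemma edges_D_iff: "{i, j} \<in> edges_D n \<longleftrightarrow> {i, j} \<in> edges_A (n - 1) \<or> i = n - 2 \<and> j = n \<or> j = n - 2 \<and> i = n"
  unfolding edges_D_def by (auto simp: doubleton_eq_iff)

text \<open>Folding identifies the two edges that join the centre \<open>k\<close> to \<open>k - 1\<close> and
\<open>k + 1\<close>. The reflection preserves the orientation, so both point to the centre or both away from it,
and their entries add up to the entry \<open>2\<close> or \<open>- 2\<close> at \<open>(k - 1, k)\<close>.\<close>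

lemma type_C_chain:
  assumes k: "2 \<le> k" and C: "type_C k V B"
  shows "V = {1..k} \<and> (\<exists>s. (\<forall>i. s i \<in> {1, - 1}) \<and>
    (\<forall>i\<in>{1..k}. \<forall>j\<in>{1..k}. B i j = chain_matrix k 2 1 s i j))"
proof -
  define \<sigma> where "\<sigma> = (\<lambda>i. 2 * k - i)"
  obtain Q where Q: "orientation (edges_A (2 * k - 1)) Q"
    and aut: "quiver_automorphism {1..2 * k - 1} Q \<sigma>"
    and V: "V = folded_vertices {id, \<sigma>} {1..2 * k - 1}"
    and B: "B = folded_matrix {id, \<sigma>} (quiver_matrix Q)"
    using C unfolding type_C_def Let_def \<sigma>_def by blast
  let ?b = "quiver_matrix Q"
  have orbit: "group_orbit {id, \<sigma>} i = {i, 2 * k - i}" for i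
    by (simp add: group_orbit_def \<sigma>_def)
  have "V = (\<lambda>i. min i (2 * k - i)) ` {1..2 * k - 1}"
    unfolding V folded_vertices_def orbit by simp
  also have "\<dots> = {1..k}"
  proof
    show "(\<lambda>i. min i (2 * k - i)) ` {1..2 * k - 1} \<subseteq> {1..k}" by auto
    show "{1..k} \<subseteq> (\<lambda>i. min i (2 * k - i)) ` {1..2 * k - 1}"
      by (auto intro!: image_eqI)
  qed
  finally have V': "V = {1..k}" .
  define s where "s i = (if 1 \<le> i \<and> i < k then ?b i (i + 1) else 1)" for i
  have edge: "{i, j} \<in> edges_A (2 * k - 1) \<longleftrightarrow>
      1 \<le> i \<and> i < 2 * k - 1 \<and> j = i + 1 \<or> 1 \<le> j \<and> j < 2 * k - 1 \<and> i = j + 1" for i j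
    by (rule edges_A_iff)
  have s: "s i \<in> {1, - 1}" for i
  proof (cases "1 \<le> i \<and> i < k")
    case True
    then have "{i, i + 1} \<in> edges_A (2 * k - 1)" unfolding edge by auto
    then show ?thesis using orientation_sign[OF Q, of i "i + 1"] True by (simp add: s_def)
  next
    case False
    then have "s i = 1" unfolding s_def by (rule if_not_P)
    then show ?thesis by simp
  qed
  have zero: "?b i j = 0" if "\<not> (j = i + 1 \<or> i = j + 1)" for i j
    by (rule orientation_nonedge[OF Q], unfold edge) (use that in auto)
  have up: "?b i (i + 1) = s i" if "1 \<le> i" "i < k" for i using that by (simp add: s_def)
  have down: "?b (i + 1) i = - s i" if "1 \<le> i" "i < k" for i
    using up[OF that] quiver_matrix_skew by metis
  have centre: "?b (k + 1) k = s (k - 1)"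
  proof -
    have "?b (\<sigma> (k - 1)) (\<sigma> k) = ?b (k - 1) k"
      by (rule quiver_automorphism_matrix[OF aut]) (use k in auto)
    moreover have "\<sigma> (k - 1) = k + 1" "\<sigma> k = k" using k by (auto simp: \<sigma>_def)
    ultimately show ?thesis using up[of "k - 1"] k by simp
  qed
  have "B i j = chain_matrix k 2 1 s i j" if ij: "i \<in> {1..k}" "j \<in> {1..k}" for i j
  proof (cases "i = k")
    case True
    then have Bij: "B i j = ?b k j" by (simp add: B folded_matrix_def orbit)
    show ?thesis
    proof (cases "k = j + 1")
      case True
      then show ?thesis using Bij \<open>i = k\<close> down[of j] ij by (simp add: chain_matrix_def weight_def)
    next
      case False
      then show ?thesis using Bij \<open>i = k\<close> zero[of j k] ij by (simp add: chain_matrix_def weight_def)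
    qed
  next
    case False
    then have ik: "i < k" "i \<noteq> 2 * k - i" using ij by auto
    then have Bij: "B i j = ?b i j + ?b (2 * k - i) j"
      by (simp add: B folded_matrix_def orbit)
    have far: "?b (2 * k - i) j = (if i + 1 = k \<and> j = k then s i else 0)"
    proof (cases "i + 1 = k \<and> j = k")
      case True
      then have "2 * k - i = k + 1" "i = k - 1" by auto
      then show ?thesis using True centre by simp
    next
      case False
      then have "?b (2 * k - i) j = 0" using ij ik by (intro zero) auto
      then show ?thesis using False by auto
    qed
    have near: "?b i j = (if j = i + 1 then s i else if i = j + 1 then - s j else 0)"
      using up[of i] down[of j] zero[of j i] ij ik by auto
    show ?thesis unfolding Bij far near using ij ik by (auto simp: chain_matrix_def weight_def)
  qed
  then show ?thesis using V' s by blast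
qed

text \<open>The two short arms are oriented alike. The row of their orbit adds up both entries, while the column is
that of one representative.\<close>

lemma type_B_chain:
  assumes k: "2 \<le> k" and T: "type_B k V B"
  shows "V = {1..k} \<and> (\<exists>s. (\<forall>i. s i \<in> {1, - 1}) \<and>
    (\<forall>i\<in>{1..k}. \<forall>j\<in>{1..k}. B i j = chain_matrix k 1 2 s i j))"
proof -
  define \<sigma> where "\<sigma> = transpose k (k + 1)"
  obtain Q where Q: "orientation (edges_D (k + 1)) Q"
    and aut: "quiver_automorphism {1..k + 1} Q \<sigma>"
    and V: "V = folded_vertices {id, \<sigma>} {1..k + 1}"
    and B: "B = folded_matrix {id, \<sigma>} (quiver_matrix Q)"
    using T unfolding type_B_def Let_def \<sigma>_def by blast
  let ?b = "quiver_matrix Q"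
  have orbit: "group_orbit {id, \<sigma>} i = (if i = k \<or> i = k + 1 then {k, k + 1} else {i})" for i
    by (auto simp: group_orbit_def \<sigma>_def transpose_def)
  have Min: "Min (group_orbit {id, \<sigma>} i) = (if i = k + 1 then k else i)" for i
    by (auto simp: orbit)
  have "V = (\<lambda>i. if i = k + 1 then k else i) ` {1..k + 1}"
    unfolding V folded_vertices_def Min ..
  also have "\<dots> = {1..k}" using k by (auto simp: image_iff)
  finally have V': "V = {1..k}" .
  define s where "s i = (if 1 \<le> i \<and> i < k then ?b i (i + 1) else 1)" for i
  have edge: "{i, j} \<in> edges_D (k + 1) \<longleftrightarrow>
      1 \<le> i \<and> i < k \<and> j = i + 1 \<or> 1 \<le> j \<and> j < k \<and> i = j + 1
      \<or> i = k - 1 \<and> j = k + 1 \<or> j = k - 1 \<and> i = k + 1" for i j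
    using k by (simp add: edges_D_iff edges_A_iff)
  have s: "s i \<in> {1, - 1}" for i
  proof (cases "1 \<le> i \<and> i < k")
    case True
    then have "{i, i + 1} \<in> edges_D (k + 1)" unfolding edge by auto
    then show ?thesis using orientation_sign[OF Q, of i "i + 1"] True by (simp add: s_def)
  next
    case False
    then have "s i = 1" unfolding s_def by (rule if_not_P)
    then show ?thesis by simp
  qed
  have zero: "?b i j = 0" if "\<not> (i < k \<and> j = i + 1 \<or> j < k \<and> i = j + 1
      \<or> i = k - 1 \<and> j = k + 1 \<or> j = k - 1 \<and> i = k + 1)" for i j
    by (rule orientation_nonedge[OF Q], unfold edge) (use that in blast)
  have up: "?b i (i + 1) = s i" if "1 \<le> i" "i < k" for i using that by (simp add: s_def)
  have down: "?b (i + 1) i = - s i" if "1 \<le> i" "i < k" for i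
    using up[OF that] quiver_matrix_skew by metis
  have short: "?b (k + 1) (k - 1) = - s (k - 1)"
  proof -
    have "?b (\<sigma> k) (\<sigma> (k - 1)) = ?b k (k - 1)"
      by (rule quiver_automorphism_matrix[OF aut]) (use k in auto)
    moreover have "\<sigma> (k - 1) = k - 1" "\<sigma> k = k + 1" using k by (auto simp: \<sigma>_def transpose_def)
    ultimately show ?thesis using down[of "k - 1"] k by simp
  qed
  have near: "?b i j = (if j = i + 1 then s i else if i = j + 1 then - s j else 0)"
    if ij: "i \<in> {1..k}" "j \<in> {1..k}" for i j
    using up[of i] down[of j] zero[of i j] ij by auto
  have "B i j = chain_matrix k 1 2 s i j" if ij: "i \<in> {1..k}" "j \<in> {1..k}" for i j
  proof (cases "i = k")
    case True
    then have Bij: "B i j = ?b k j + ?b (k + 1) j" by (simp add: B folded_matrix_def orbit)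
    have far: "?b (k + 1) j = (if j + 1 = k then - s j else 0)"
      using short zero[of "k + 1" j] ij by auto
    show ?thesis unfolding Bij far using near[of k j] True ij by (auto simp: chain_matrix_def weight_def)
  next
    case False
    then have "B i j = ?b i j" using ij by (simp add: B folded_matrix_def orbit)
    then show ?thesis using near[OF ij] False ij by (auto simp: chain_matrix_def weight_def)
  qed
  then show ?thesis using V' s by blast
qed

theorem theorem1p3:
  fixes k :: nat and V :: "nat set" and B :: "nat \<Rightarrow> nat \<Rightarrow> int"
  assumes "2 \<le> k"
    and "type_B k V B \<or> type_C k V B"
  shows "nonzero_friezes V B \<approx> (UNIV :: bool set) \<times> positive_friezes V B
    \<and> card (nonzero_friezes V B) = 2 * card (positive_friezes V B)"
proof -
  have "nonzero_friezes V B \<approx> (UNIV :: bool set) \<times> positive_friezes V B"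
    using assms(2)
  proof
    assume "type_B k V B"
    from type_B_chain[OF assms(1) this] obtain s where V: "V = {1..k}"
      and s: "\<And>i. s i \<in> {1, - 1}"
      and B: "\<And>i j. i \<in> {1..k} \<Longrightarrow> j \<in> {1..k} \<Longrightarrow> B i j = chain_matrix k 1 2 s i j"
      by blast
    let ?d = "\<lambda>i. if i = k then 1 else 0 :: nat"
    show ?thesis
      unfolding V
    proof (rule friezes_double)
      show "skew_by (\<lambda>i. if i = k then int 1 else int 2) {1..k} B"
        by (rule chain_skew[OF assms(1) _ _ B s]) auto
      show "parity_grading ?d {1..k} B"
        by (rule chain_parity_grading[OF assms(1) _ _ B s chain_parity_B]) auto
      show "\<exists>i\<in>{1..k}. odd (?d i)" using assms(1) by (intro bexI[of _ k]) auto
      show "(\<forall>i\<in>{1..k}. 0 < f (var i)) \<or> (\<forall>i\<in>{1..k}. 0 < (- 1) ^ ?d i * f (var i))"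
        if "f \<in> nonzero_friezes {1..k} B" for f
        by (rule signs_B[OF assms(1) s that B])
    qed simp
  next
    assume "type_C k V B"
    from type_C_chain[OF assms(1) this] obtain s where V: "V = {1..k}"
      and s: "\<And>i. s i \<in> {1, - 1}"
      and B: "\<And>i j. i \<in> {1..k} \<Longrightarrow> j \<in> {1..k} \<Longrightarrow> B i j = chain_matrix k 2 1 s i j"
      by blast
    show ?thesis
      unfolding V
    proof (rule friezes_double)
      show "skew_by (\<lambda>i. if i = k then int 2 else int 1) {1..k} B"
        by (rule chain_skew[OF assms(1) _ _ B s]) auto
      show "parity_grading (\<lambda>i. i) {1..k} B"
        by (rule chain_parity_grading[OF assms(1) _ _ B s chain_parity_C]) auto
      show "\<exists>i\<in>{1..k}. odd i" using assms(1) by (intro bexI[of _ 1]) auto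
      show "(\<forall>i\<in>{1..k}. 0 < f (var i)) \<or> (\<forall>i\<in>{1..k}. 0 < (- 1) ^ i * f (var i))"
        if "f \<in> nonzero_friezes {1..k} B" for f
        by (rule signs_C[OF assms(1) s that B])
    qed simp
  qed
  moreover from this have "card (nonzero_friezes V B) = 2 * card (positive_friezes V B)"
    unfolding eqpoll_def using bij_betw_same_card by (fastforce simp: card_cartesian_product)
  ultimately show ?thesis ..
qed

end
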